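(* Let $V$ be an irreducible uniformly bounded weight module for $(\mathcal{S}_N\ltimes A_N)\otimes B$ on which $t^{\mathbf{0}}$ acts non-trivially and $t^{\mathbf{s}}$ acts non-trivially for some $\mathbf{s}\ne\mathbf{0}$. Then there exists an algebra homomorphism $\psi:B\to\mathbb{C}$ such that $t^{\mathbf{r}}b\cdot v=\psi(b)t^{\mathbf{r}}\cdot v$ for every $\mathbf{r}\in\mathbb{Z}^N\setminus\{\mathbf{0}\}$, $b\in B$ and $v\in V$.
   Context: All vector spaces, algebras and tensor products are over $\mathbb{C}$; $B$ is a finitely generated commutative associative unital algebra; $N\ge 2$ is an integer. $A_N=\mathbb{C}[t_1^{\pm1},\dots,t_N^{\pm1}]$, $t^{\mathbf{m}}=t_1^{m_1}\cdots t_N^{m_N}$, $d_i=t_i\frac{d}{dt_i}$, $(x|y)=\sum_ix_iy_i$. For $u\in\mathbb{C}^N$, $\mathbf{r}\in\mathbb{Z}^N$ put $D(u,\mathbf{r})=\sum_iu_it^{\mathbf{r}}d_i$; $\mathcal{S}_N=\mathrm{span}\{D(u,\mathbf{r})\mid(u|\mathbf{r})=0\}$ with $[D(u,\mathbf{r}),D(v,\mathbf{s})]=D((u|\mathbf{s})v-(v|\mathbf{r})u,\mathbf{r}+\mathbf{s})$. In $\mathcal{S}_N\ltimes A_N$, $A_N$ is an abelian ideal and $[D(u,\mathbf{r}),t^{\mathbf{s}}]=(u|\mathbf{s})t^{\mathbf{r}+\mathbf{s}}$. For a Lie algebra $\mathfrak{g}$, $\mathfrak{g}\otimes B$ has bracket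 $[x\otimes b_1,y\otimes b_2]=[x,y]\otimes b_1b_2$; write $xb=x\otimes b$ and $x=x\otimes1$. $\mathfrak{h}=\mathrm{span}\{d_1,\dots,d_N\}$. A uniformly bounded weight module is a module $V=\bigoplus_{\lambda\in\mathfrak{h}^*}V_\lambda$, $V_\lambda=\{v\mid hv=\lambda(h)v\ \forall h\in\mathfrak{h}\}$, for which there is a positive integer $M$ with $\dim V_\lambda\le M$ for all $\lambda$. *)

theory Defs
  imports "HOL-Analysis.Analysis" "HOL-Library.Poly_Mapping"
begin

section \<open>Complex vector spaces, algebras and Lie algebras\<close>

class complex_vector = ab_group_add +
  fixes scaleC :: "complex \<Rightarrow> 'a \<Rightarrow> 'a"  (infixr \<open>*\<^sub>C\<close> 75)
  assumes scaleC_add_right: "a *\<^sub>C (x + y) = a *\<^sub>C x + a *\<^sub>C y"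
    and scaleC_add_left: "(a + b) *\<^sub>C x = a *\<^sub>C x + b *\<^sub>C x"
    and scaleC_scaleC [simp]: "a *\<^sub>C b *\<^sub>C x = (a * b) *\<^sub>C x"
    and scaleC_one [simp]: "1 *\<^sub>C x = x"

global_interpretation complex_vector: vector_space "scaleC :: complex \<Rightarrow> 'a \<Rightarrow> 'a::complex_vector"
  defines csubspace = complex_vector.subspace
    and cspan = complex_vector.span
    and cdependent = complex_vector.dependent
  by unfold_locales (simp_all add: scaleC_add_right scaleC_add_left)

class complex_comm_algebra_1 = complex_vector + comm_ring_1 +
  assumes scaleC_mult_left: "(a *\<^sub>C x) * y = a *\<^sub>C (x * y)"

class complex_lie_algebra = complex_vector +
  fixes lie :: "'a \<Rightarrow> 'a \<Rightarrow> 'a"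
  assumes lie_add_left: "lie (x + y) z = lie x z + lie y z"
    and lie_add_right: "lie x (y + z) = lie x y + lie x z"
    and lie_scaleC_left: "lie (a *\<^sub>C x) y = a *\<^sub>C lie x y"
    and lie_scaleC_right: "lie x (a *\<^sub>C y) = a *\<^sub>C lie x y"
    and lie_self: "lie x x = 0"
    and lie_jacobi: "lie x (lie y z) + lie y (lie z x) + lie z (lie x y) = 0"

definition csubalgebra :: "'b::complex_comm_algebra_1 set \<Rightarrow> bool" where
  "csubalgebra A \<longleftrightarrow> csubspace A \<and> 1 \<in> A \<and> (\<forall>x\<in>A. \<forall>y\<in>A. x * y \<in> A)"

definition finitely_generated_algebra :: "'b::complex_comm_algebra_1 itself \<Rightarrow> bool" where
  "finitely_generated_algebra _ \<longleftrightarrow> (\<exists>G::'b set. finite G \<and> csubalgebra hull G = UNIV)"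

definition algebra_hom_to_complex :: "('b::complex_comm_algebra_1 \<Rightarrow> complex) \<Rightarrow> bool" where
  "algebra_hom_to_complex \<psi> \<longleftrightarrow>
     (\<forall>x y. \<psi> (x + y) = \<psi> x + \<psi> y) \<and> (\<forall>a x. \<psi> (a *\<^sub>C x) = a * \<psi> x) \<and>
     (\<forall>x y. \<psi> (x * y) = \<psi> x * \<psi> y) \<and> \<psi> 1 = 1"

definition cbilinear :: "('a::complex_vector \<Rightarrow> 'b::complex_vector \<Rightarrow> 'c::complex_vector) \<Rightarrow> bool" where
  "cbilinear f \<longleftrightarrow>
     (\<forall>x x' y. f (x + x') y = f x y + f x' y) \<and> (\<forall>x y y'. f x (y + y') = f x y + f x y') \<and>
     (\<forall>a x y. f (a *\<^sub>C x) y = a *\<^sub>C f x y) \<and> (\<forall>a x y. f x (a *\<^sub>C y) = a *\<^sub>C f x y)"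

instantiation complex :: complex_vector
begin
definition scaleC_complex :: "complex \<Rightarrow> complex \<Rightarrow> complex" where "scaleC_complex a x = a * x"
instance by standard (simp_all add: scaleC_complex_def algebra_simps)
end

instantiation prod :: (complex_vector, complex_vector) complex_vector
begin
definition scaleC_prod :: "complex \<Rightarrow> 'a \<times> 'b \<Rightarrow> 'a \<times> 'b"
  where "scaleC_prod a x = (a *\<^sub>C fst x, a *\<^sub>C snd x)"
instance by standard (simp_all add: scaleC_prod_def prod_eq_iff scaleC_add_right scaleC_add_left)
end

instantiation vec :: (complex_vector, finite) complex_vector
begin
definition scaleC_vec :: "complex \<Rightarrow> 'a ^ 'b \<Rightarrow> 'a ^ 'b" where "scaleC_vec a x = (\<chi> i. a *\<^sub>C x $ i)"
instance by standard (simp_all add: scaleC_vec_def vec_eq_iff scaleC_add_right scaleC_add_left)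
end

lemma scaleC_nth [simp]: "(a *\<^sub>C x) $ i = a *\<^sub>C x $ i"
  by (simp add: scaleC_vec_def)

instantiation poly_mapping :: (type, complex_vector) complex_vector
begin
definition scaleC_poly_mapping :: "complex \<Rightarrow> ('a \<Rightarrow>\<^sub>0 'b) \<Rightarrow> 'a \<Rightarrow>\<^sub>0 'b"
  where "scaleC_poly_mapping a p = Poly_Mapping.map (scaleC a) p"

lemma lookup_scaleC [simp]:
  "Poly_Mapping.lookup (a *\<^sub>C p) k = a *\<^sub>C Poly_Mapping.lookup (p :: 'a \<Rightarrow>\<^sub>0 'b) k"
  by (simp add: scaleC_poly_mapping_def map.rep_eq when_def)

instance
  by standard (simp_all add: poly_mapping_eq_iff fun_eq_iff lookup_add scaleC_add_right scaleC_add_left)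
end

lemma lookup_scaleC' [simp]:
  "Poly_Mapping.lookup (a *\<^sub>C p) k = a *\<^sub>C Poly_Mapping.lookup p k"
  by (rule lookup_scaleC)

lemma scaleC_single: "a *\<^sub>C Poly_Mapping.single k x = Poly_Mapping.single k (a *\<^sub>C x)"
  by (rule poly_mapping_eqI) (simp add: lookup_single when_def)

lemma poly_mapping_single_induct [case_names single add]:
  assumes single: "\<And>k c. P (Poly_Mapping.single k c)" and add: "\<And>p q. P p \<Longrightarrow> P q \<Longrightarrow> P (p + q)"
  shows "P p"
proof (induction p rule: update_induct)
  case const
  show ?case using single[of undefined 0] by simp
next
  case (update p k c)
  have "Poly_Mapping.update k c p = p + Poly_Mapping.single k c"
    using update(1)
    by (intro poly_mapping_eqI) (auto simp: lookup_update lookup_add lookup_single when_def in_keys_iff)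
  then show ?case using add[OF update(3) single] by simp
qed


section \<open>Tensor products\<close>

text \<open>The tensor product is the quotient of the free vector space on pairs by the span of the
  usual bilinearity relators.\<close>

definition tensor_relators :: "(('a::complex_vector \<times> 'b::complex_vector) \<Rightarrow>\<^sub>0 complex) set" where
  "tensor_relators = (let e = (\<lambda>x b. Poly_Mapping.single (x, b) 1) in
     {e (x + x') b - e x b - e x' b |x x' b. True} \<union>
     {e x (b + b') - e x b - e x b' |x b b'. True} \<union>
     {e (a *\<^sub>C x) b - a *\<^sub>C e x b |a x b. True} \<union>
     {e x (a *\<^sub>C b) - a *\<^sub>C e x b |a x b. True})"

definition tensor_rel ::
  "(('a::complex_vector \<times> 'b::complex_vector) \<Rightarrow>\<^sub>0 complex) \<Rightarrow> (('a \<times> 'b) \<Rightarrow>\<^sub>0 complex) \<Rightarrow> bool" where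
  "tensor_rel p q \<longleftrightarrow> p - q \<in> cspan tensor_relators"

quotient_type (overloaded) ('a, 'b) tensor =
  "('a::complex_vector \<times> 'b::complex_vector) \<Rightarrow>\<^sub>0 complex" / tensor_rel
proof (rule equivpI)
  show "reflp (tensor_rel :: (('a \<times> 'b) \<Rightarrow>\<^sub>0 complex) \<Rightarrow> _)"
    by (auto intro!: reflpI simp: tensor_rel_def complex_vector.span_zero)
  show "symp (tensor_rel :: (('a \<times> 'b) \<Rightarrow>\<^sub>0 complex) \<Rightarrow> _)"
    by (rule sympI, unfold tensor_rel_def, drule complex_vector.span_neg) simp
  show "transp (tensor_rel :: (('a \<times> 'b) \<Rightarrow>\<^sub>0 complex) \<Rightarrow> _)"
    by (rule transpI, unfold tensor_rel_def, drule (1) complex_vector.span_add) simp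
qed

instantiation tensor :: (complex_vector, complex_vector) complex_vector
begin

lift_definition zero_tensor :: "('a, 'b) tensor" is 0 .

lift_definition plus_tensor :: "('a, 'b) tensor \<Rightarrow> ('a, 'b) tensor \<Rightarrow> ('a, 'b) tensor" is "(+)"
  unfolding tensor_rel_def by (drule (1) complex_vector.span_add) (simp add: algebra_simps)

lift_definition minus_tensor :: "('a, 'b) tensor \<Rightarrow> ('a, 'b) tensor \<Rightarrow> ('a, 'b) tensor" is "(-)"
  unfolding tensor_rel_def by (drule (1) complex_vector.span_diff) (simp add: algebra_simps)

lift_definition uminus_tensor :: "('a, 'b) tensor \<Rightarrow> ('a, 'b) tensor" is uminus
  unfolding tensor_rel_def by (drule complex_vector.span_neg) (simp add: algebra_simps)

lift_definition scaleC_tensor :: "complex \<Rightarrow> ('a, 'b) tensor \<Rightarrow> ('a, 'b) tensor" is scaleC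
  unfolding tensor_rel_def by (metis complex_vector.span_scale complex_vector.scale_right_diff_distrib)

instance
proof
  fix a b c :: "('a, 'b) tensor" and k l :: complex
  have r: "p = q \<Longrightarrow> tensor_rel p q" for p q :: "('a \<times> 'b) \<Rightarrow>\<^sub>0 complex"
    by (simp add: tensor_rel_def complex_vector.span_zero)
  show "a + b + c = a + (b + c)" by transfer (simp add: r algebra_simps)
  show "a + b = b + a" by transfer (simp add: r algebra_simps)
  show "0 + a = a" by transfer (simp add: r)
  show "- a + a = 0" by transfer (simp add: r)
  show "a - b = a + - b" by transfer (simp add: r)
  show "k *\<^sub>C (a + b) = k *\<^sub>C a + k *\<^sub>C b" by transfer (simp add: r scaleC_add_right)
  show "(k + l) *\<^sub>C a = k *\<^sub>C a + l *\<^sub>C a" by transfer (simp add: r scaleC_add_left)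
  show "k *\<^sub>C l *\<^sub>C a = (k * l) *\<^sub>C a" by transfer (simp add: r)
  show "1 *\<^sub>C a = a" by transfer (simp add: r)
qed

end

lift_definition pure_tensor :: "'a::complex_vector \<Rightarrow> 'b::complex_vector \<Rightarrow> ('a, 'b) tensor"
    (infixr \<open>\<otimes>\<close> 76)
  is "\<lambda>x b. Poly_Mapping.single (x, b) 1" .

lemma abs_rep_tensor: "abs_tensor (rep_tensor t) = t"
  by (rule Quotient3_abs_rep[OF Quotient3_tensor])

lemma cbilinear_pure_tensor: "cbilinear pure_tensor"
proof -
  have r: "p \<in> tensor_relators \<Longrightarrow> p \<in> cspan tensor_relators"
    for p :: "('a \<times> 'b) \<Rightarrow>\<^sub>0 complex"
    by (rule complex_vector.span_base)
  show ?thesis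
    unfolding cbilinear_def
    by (intro conjI allI; transfer; unfold tensor_rel_def diff_diff_add[symmetric]; rule r;
        unfold tensor_relators_def Let_def; blast)
qed

lemmas
  tensor_add_left = cbilinear_pure_tensor[unfolded cbilinear_def, THEN conjunct1, rule_format]
  and tensor_add_right = cbilinear_pure_tensor[unfolded cbilinear_def, THEN conjunct2, THEN conjunct1, rule_format]
  and tensor_scaleC_left = cbilinear_pure_tensor[unfolded cbilinear_def, THEN conjunct2, THEN conjunct2, THEN conjunct1, rule_format]
  and tensor_scaleC_right = cbilinear_pure_tensor[unfolded cbilinear_def, THEN conjunct2, THEN conjunct2, THEN conjunct2, rule_format]

lemma tensor_induct [case_names pure add, induct type: tensor]:
  assumes pure: "\<And>x b. P (x \<otimes> b)" and add: "\<And>s t. P s \<Longrightarrow> P t \<Longrightarrow> P (s + t)"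
  shows "P t"
proof -
  have "P (abs_tensor p)" for p
  proof (induction p rule: poly_mapping_single_induct)
    case (single k c)
    obtain x b where k: "k = (x, b)" by force
    have "(c *\<^sub>C x) \<otimes> b = c *\<^sub>C (x \<otimes> b)" by (rule tensor_scaleC_left)
    also have "\<dots> = abs_tensor (c *\<^sub>C Poly_Mapping.single (x, b) 1)"
      by (simp add: pure_tensor.abs_eq scaleC_tensor.abs_eq)
    also have "\<dots> = abs_tensor (Poly_Mapping.single k c)"
      by (simp add: scaleC_single k scaleC_complex_def)
    finally show ?case using pure by metis
  next
    case (add p q)
    then show ?case using assms(2) by (simp flip: plus_tensor.abs_eq)
  qed
  from this[of "rep_tensor t"] show ?thesis by (simp add: abs_rep_tensor)
qed

text \<open>The linear map on the tensor product induced by a bilinear map.\<close>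

definition linear_extension :: "('k \<Rightarrow> 'c::complex_vector) \<Rightarrow> ('k \<Rightarrow>\<^sub>0 complex) \<Rightarrow> 'c" where
  "linear_extension f p = (\<Sum>k\<in>Poly_Mapping.keys p. Poly_Mapping.lookup p k *\<^sub>C f k)"

definition tensor_lift ::
  "('a::complex_vector \<Rightarrow> 'b::complex_vector \<Rightarrow> 'c::complex_vector) \<Rightarrow> ('a, 'b) tensor \<Rightarrow> 'c" where
  "tensor_lift f t = linear_extension (case_prod f) (rep_tensor t)"

lemma linear_extension_superset:
  "finite S \<Longrightarrow> Poly_Mapping.keys p \<subseteq> S \<Longrightarrow>
    linear_extension f p = (\<Sum>k\<in>S. Poly_Mapping.lookup p k *\<^sub>C f k)"
  unfolding linear_extension_def by (rule sum.mono_neutral_left) (auto simp: in_keys_iff)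

lemma linear_extension_add: "linear_extension f (p + q) = linear_extension f p + linear_extension f q"
proof -
  let ?S = "Poly_Mapping.keys p \<union> Poly_Mapping.keys q"
  have "finite ?S" "Poly_Mapping.keys (p + q) \<subseteq> ?S" by (simp_all add: keys_add)
  then show ?thesis
    by (simp add: linear_extension_superset[of ?S] lookup_add scaleC_add_left sum.distrib)
qed

lemma linear_extension_scaleC: "linear_extension f (a *\<^sub>C p) = a *\<^sub>C linear_extension f p"
proof -
  have "Poly_Mapping.keys (a *\<^sub>C p) \<subseteq> Poly_Mapping.keys p"
    by (auto simp: in_keys_iff scaleC_complex_def)
  then show ?thesis
    by (simp add: linear_extension_superset[of "Poly_Mapping.keys p"] scaleC_complex_def
        complex_vector.scale_sum_right)
qed

lemma linear_extension_diff: "linear_extension f (p - q) = linear_extension f p - linear_extension f q"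
  by (metis add_diff_cancel_right' diff_add_cancel linear_extension_add)

lemma linear_extension_single [simp]: "linear_extension f (Poly_Mapping.single k c) = c *\<^sub>C f k"
  by (cases "c = 0") (simp_all add: linear_extension_def)

lemma linear_extension_relators:
  assumes f: "cbilinear f" and p: "p \<in> cspan tensor_relators"
  shows "linear_extension (case_prod f) p = 0"
  using p
proof (induction rule: complex_vector.span_induct)
  case base
  show ?case
    by (auto simp: complex_vector.subspace_def linear_extension_add linear_extension_scaleC)
      (simp add: linear_extension_def)
next
  case (step p)
  then show ?case
    using f unfolding tensor_relators_def Let_def cbilinear_def
    by (elim UnE CollectE exE conjE) (simp_all add: linear_extension_diff linear_extension_scaleC)
qed

lemma tensor_lift_abs:
  assumes f: "cbilinear f"
  shows "tensor_lift f (abs_tensor p) = linear_extension (case_prod f) p"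
proof -
  have "tensor_rel (rep_tensor (abs_tensor p)) p"
    by (simp flip: tensor.abs_eq_iff add: abs_rep_tensor)
  then have "linear_extension (case_prod f) (rep_tensor (abs_tensor p) - p) = 0"
    unfolding tensor_rel_def by (rule linear_extension_relators[OF f])
  then show ?thesis
    by (simp add: linear_extension_diff tensor_lift_def)
qed

lemma tensor_lift_pure [simp]: "cbilinear f \<Longrightarrow> tensor_lift f (x \<otimes> b) = f x b"
  by (simp add: pure_tensor.abs_eq tensor_lift_abs)

lemma tensor_lift_add:
  assumes "cbilinear f"
  shows "tensor_lift f (s + t) = tensor_lift f s + tensor_lift f t"
proof -
  have "tensor_lift f (abs_tensor p + abs_tensor q)
      = tensor_lift f (abs_tensor p) + tensor_lift f (abs_tensor q)" for p q
    by (simp add: plus_tensor.abs_eq tensor_lift_abs assms linear_extension_add)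
  from this[of "rep_tensor s" "rep_tensor t"] show ?thesis by (simp add: abs_rep_tensor)
qed

lemma tensor_lift_scaleC:
  assumes "cbilinear f"
  shows "tensor_lift f (a *\<^sub>C t) = a *\<^sub>C tensor_lift f t"
proof -
  have "tensor_lift f (a *\<^sub>C abs_tensor p) = a *\<^sub>C tensor_lift f (abs_tensor p)" for p
    by (simp add: scaleC_tensor.abs_eq tensor_lift_abs assms linear_extension_scaleC)
  from this[of "rep_tensor t"] show ?thesis by (simp add: abs_rep_tensor)
qed


section \<open>The Lie algebra of a Lie algebra tensored with a commutative algebra\<close>

lemma scaleC_mult_right: "x * (a *\<^sub>C y) = a *\<^sub>C (x * y)" for x y :: "'b::complex_comm_algebra_1"
  by (metis mult.commute scaleC_mult_left)

lemma lie_skew: "lie y x = - lie x y" for x y :: "'a::complex_lie_algebra"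
proof -
  have "lie (x + y) (x + y) = lie x y + lie y x"
    unfolding lie_add_left lie_add_right by (simp add: lie_self)
  then have "lie x y + lie y x = 0" by (simp add: lie_self)
  then show ?thesis by (simp add: eq_neg_iff_add_eq_0 add.commute)
qed

instantiation tensor :: (complex_lie_algebra, complex_comm_algebra_1) complex_lie_algebra
begin

definition lie_tensor :: "('a, 'b) tensor \<Rightarrow> ('a, 'b) tensor \<Rightarrow> ('a, 'b) tensor" where
  "lie_tensor s t = tensor_lift (\<lambda>x b. tensor_lift (\<lambda>y c. lie x y \<otimes> (b * c)) t) s"

lemma lie_tensor_bilinear_aux:
  fixes x :: 'a and b :: 'b
  shows "cbilinear (\<lambda>y c. lie x y \<otimes> (b * c))"
  unfolding cbilinear_def
  by (simp add: lie_add_right lie_scaleC_right tensor_add_left tensor_add_right tensor_scaleC_left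
      tensor_scaleC_right distrib_left scaleC_mult_right)

lemma lie_tensor_bilinear_aux2:
  fixes t :: "('a, 'b) tensor"
  shows "cbilinear (\<lambda>x b. tensor_lift (\<lambda>y c. lie x y \<otimes> (b * c)) t)"
proof (induction t rule: tensor_induct)
  case (pure y c)
  show ?case
    unfolding cbilinear_def tensor_lift_pure[OF lie_tensor_bilinear_aux]
    by (simp add: lie_add_left lie_scaleC_left tensor_add_left
        tensor_add_right tensor_scaleC_left tensor_scaleC_right distrib_right scaleC_mult_left)
next
  case (add s t)
  then show ?case
    unfolding cbilinear_def tensor_lift_add[OF lie_tensor_bilinear_aux]
    by (simp add: scaleC_add_right add.assoc add.left_commute)
qed

lemma lie_pure_tensor:
  fixes x y :: 'a and b c :: 'b
  shows "lie (x \<otimes> b) (y \<otimes> c) = lie x y \<otimes> (b * c)"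
  unfolding lie_tensor_def
  by (rule trans[OF tensor_lift_pure[OF lie_tensor_bilinear_aux2]
        tensor_lift_pure[OF lie_tensor_bilinear_aux]])

instance
proof
  fix r s t :: "('a, 'b) tensor" and a :: complex
  show al: "lie (r + s) t = lie r t + lie s t" for r s t :: "('a, 'b) tensor"
    by (simp add: lie_tensor_def lie_tensor_bilinear_aux2 tensor_lift_add)
  show sl: "lie (a *\<^sub>C r) t = a *\<^sub>C lie r t"
    by (simp add: lie_tensor_def lie_tensor_bilinear_aux2 tensor_lift_scaleC)
  show ar: "lie r (s + t) = lie r s + lie r t" for r s t :: "('a, 'b) tensor"
  proof (induction r rule: tensor_induct)
    case (pure x b)
    show ?case
      unfolding lie_tensor_def tensor_lift_pure[OF lie_tensor_bilinear_aux2]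
      by (rule tensor_lift_add[OF lie_tensor_bilinear_aux])
  next
    case (add r1 r2)
    then show ?case by (simp add: al)
  qed
  show "lie r (a *\<^sub>C t) = a *\<^sub>C lie r t"
  proof (induction r rule: tensor_induct)
    case (pure x b)
    show ?case
      unfolding lie_tensor_def tensor_lift_pure[OF lie_tensor_bilinear_aux2]
      by (rule tensor_lift_scaleC[OF lie_tensor_bilinear_aux])
  next
    case (add r1 r2)
    then show ?case by (simp add: al scaleC_add_right)
  qed
  have neg: "(- x) \<otimes> b = - (x \<otimes> b)" for x :: 'a and b :: 'b
    using tensor_scaleC_left[of "-1" x b] by simp
  have skew: "lie s r + lie r s = 0" for r s :: "('a, 'b) tensor"
  proof (induction r rule: tensor_induct)
    case (pure x b)
    show ?case
    proof (induction s rule: tensor_induct)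
      case (pure y c)
      show ?case
        by (simp add: lie_pure_tensor lie_skew[of x y] neg mult.commute)
    next
      case (add s1 s2)
      then show ?case by (simp add: al ar) (metis add.assoc add.left_commute add_0)
    qed
  next
    case (add r1 r2)
    then show ?case by (simp add: al ar) (metis add.assoc add.left_commute add_0)
  qed
  show "lie r r = 0"
  proof (induction r rule: tensor_induct)
    case (pure x b)
    show ?case using tensor_scaleC_left[of 0] by (simp add: lie_pure_tensor lie_self)
  next
    case (add r s)
    then show ?case using skew[of r s] by (simp add: al ar add.commute)
  qed
  define J where "J r s t = lie r (lie s t) + lie s (lie t r) + lie t (lie r s)"
    for r s t :: "('a, 'b) tensor"
  have J_add: "J (r + r') s t = J r s t + J r' s t" "J r (s + s') t = J r s t + J r s' t"
    "J r s (t + t') = J r s t + J r s t'" for r r' s s' t t'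
    unfolding J_def by (simp_all add: al ar add.assoc add.left_commute)
  have "J r s t = 0"
  proof (induction r rule: tensor_induct)
    case r: (pure x b)
    show ?case
    proof (induction s rule: tensor_induct)
      case s: (pure y c)
      show ?case
      proof (induction t rule: tensor_induct)
        case t: (pure z d)
        have "lie x (lie y z) \<otimes> (b * c * d) + lie y (lie z x) \<otimes> (b * c * d)
            + lie z (lie x y) \<otimes> (b * c * d) = 0"
          using tensor_scaleC_left[of 0] lie_jacobi[of x y z] by (simp flip: tensor_add_left)
        then show ?case by (simp add: J_def lie_pure_tensor ac_simps)
      qed (simp add: J_add)
    qed (simp add: J_add)
  qed (simp add: J_add)
  then show "lie r (lie s t) + lie s (lie t r) + lie t (lie r s) = 0"
    by (simp add: J_def)
qed

end


section \<open>The Lie algebra of divergence-zero vector fields on a torus, with Laurent polynomials\<close>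

text \<open>Exponents are integer vectors; multiplication of poly mappings is convolution, so
  \<open>Poly_Mapping.single r 1\<close> is the monomial with exponent \<open>r\<close>.\<close>

type_synonym 'n laurent = "(int ^ 'n) \<Rightarrow>\<^sub>0 complex"

text \<open>\<open>euler i\<close> is the derivation \<open>t\<^sub>i d/dt\<^sub>i\<close>. A vector field \<open>X\<close> stands for
  the derivation \<open>\<Sum>i. X $ i * euler i\<close>.\<close>

definition euler :: "'n::finite \<Rightarrow> 'n laurent \<Rightarrow> 'n laurent" where
  "euler i f = Poly_Mapping.mapp (\<lambda>r c. of_int (r $ i) * c) f"

definition vf_apply :: "('n::finite) laurent ^ 'n \<Rightarrow> 'n laurent \<Rightarrow> 'n laurent" where
  "vf_apply X f = (\<Sum>i\<in>UNIV. X $ i * euler i f)"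

definition vf_bracket :: "('n::finite) laurent ^ 'n \<Rightarrow> 'n laurent ^ 'n \<Rightarrow> 'n laurent ^ 'n" where
  "vf_bracket X Y = (\<chi> i. vf_apply X (Y $ i) - vf_apply Y (X $ i))"

definition cpair :: "complex ^ 'n::finite \<Rightarrow> int ^ 'n \<Rightarrow> complex" where
  "cpair u r = (\<Sum>i\<in>UNIV. u $ i * of_int (r $ i))"

definition vf_D :: "complex ^ 'n::finite \<Rightarrow> int ^ 'n \<Rightarrow> 'n laurent ^ 'n" where
  "vf_D u r = (\<chi> i. Poly_Mapping.single r (u $ i))"

definition S_N :: "(('n::finite) laurent ^ 'n) set" where
  "S_N = cspan {vf_D u r |u r. cpair u r = 0}"

lemma lookup_euler: "Poly_Mapping.lookup (euler i f) r = of_int (r $ i) * Poly_Mapping.lookup f r"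
  by (simp add: euler_def lookup_mapp in_keys_iff when_def)

lemma euler_single [simp]:
  "euler i (Poly_Mapping.single r c) = Poly_Mapping.single r (of_int (r $ i) * c)"
  by (rule poly_mapping_eqI) (simp add: lookup_euler lookup_single when_def)

lemma euler_add: "euler i (f + g) = euler i f + euler i g"
  by (rule poly_mapping_eqI) (simp add: lookup_euler lookup_add algebra_simps)

lemma euler_diff: "euler i (f - g) = euler i f - euler i g"
  by (rule poly_mapping_eqI) (simp add: lookup_euler lookup_minus algebra_simps)

lemma euler_scaleC: "euler i (a *\<^sub>C f) = a *\<^sub>C euler i f"
  by (rule poly_mapping_eqI) (simp add: lookup_euler scaleC_complex_def)

lemma euler_sum: "euler i (sum f A) = (\<Sum>a\<in>A. euler i (f a))"
  by (rule poly_mapping_eqI) (simp add: lookup_euler lookup_sum sum_distrib_left)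

lemma euler_commute: "euler i (euler j f) = euler j (euler i f)"
  by (rule poly_mapping_eqI) (simp add: lookup_euler)

lemma euler_mult: "euler i (f * g) = euler i f * g + f * euler i g"
proof (induction f rule: poly_mapping_single_induct)
  case (single r c)
  show ?case
  proof (induction g rule: poly_mapping_single_induct)
    case (single s d)
    show ?case by (simp add: mult_single algebra_simps flip: single_add)
  next
    case (add g h)
    then show ?case by (simp add: euler_add algebra_simps)
  qed
next
  case (add f h)
  then show ?case by (simp add: euler_add algebra_simps)
qed

lemma scaleC_laurent_mult:
  fixes f g :: "('n::finite) laurent"
  shows "(a *\<^sub>C f) * g = a *\<^sub>C (f * g)" "f * (a *\<^sub>C g) = a *\<^sub>C (f * g)"
proof -
  have e: "a *\<^sub>C f = Poly_Mapping.single 0 a * f" for f :: "'n laurent"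
  proof (induction f rule: poly_mapping_single_induct)
    case (single k c)
    show ?case by (simp add: mult_single scaleC_single scaleC_complex_def)
  qed (simp add: scaleC_add_right distrib_left)
  show "(a *\<^sub>C f) * g = a *\<^sub>C (f * g)" "f * (a *\<^sub>C g) = a *\<^sub>C (f * g)"
    by (simp_all add: e ac_simps)
qed

lemma vf_apply_add_right: "vf_apply X (f + g) = vf_apply X f + vf_apply X g"
  and vf_apply_diff_right: "vf_apply X (f - g) = vf_apply X f - vf_apply X g"
  and vf_apply_add_left: "vf_apply (X + Y) f = vf_apply X f + vf_apply Y f"
  and vf_apply_scaleC_right: "vf_apply X (a *\<^sub>C f) = a *\<^sub>C vf_apply X f"
  and vf_apply_scaleC_left: "vf_apply (a *\<^sub>C X) f = a *\<^sub>C vf_apply X f"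
  by (simp_all add: vf_apply_def euler_add euler_diff euler_scaleC scaleC_laurent_mult
      distrib_left distrib_right right_diff_distrib sum.distrib sum_subtractf
      complex_vector.scale_sum_right)

lemma vf_apply_bracket:
  "vf_apply (vf_bracket X Y) f = vf_apply X (vf_apply Y f) - vf_apply Y (vf_apply X f)"
proof -
  have *: "vf_apply X (vf_apply Y f) =
      (\<Sum>i\<in>UNIV. vf_apply X (Y $ i) * euler i f) +
      (\<Sum>i\<in>UNIV. \<Sum>j\<in>UNIV. X $ j * (Y $ i * euler j (euler i f)))" for X Y
    unfolding vf_apply_def
    by (simp add: euler_sum euler_mult sum_distrib_left sum_distrib_right distrib_left sum.distrib
        mult.assoc)
      (subst (1 2) sum.swap, rule refl)
  have "(\<Sum>i\<in>UNIV. \<Sum>j\<in>UNIV. X $ j * (Y $ i * euler j (euler i f))) =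
      (\<Sum>i\<in>UNIV. \<Sum>j\<in>UNIV. Y $ j * (X $ i * euler j (euler i f)))"
    by (subst sum.swap) (simp add: euler_commute mult.left_commute)
  then show ?thesis
    unfolding *[of X Y] *[of Y X] unfolding vf_apply_def[of "vf_bracket X Y"]
    by (simp add: vf_bracket_def left_diff_distrib sum_subtractf)
qed

lemma single_sum: "Poly_Mapping.single k (sum f A) = (\<Sum>a\<in>A. Poly_Mapping.single k (f a))"
  by (rule poly_mapping_eqI) (simp add: lookup_single lookup_sum when_def)

lemma vf_apply_D:
  "vf_apply (vf_D u r) (Poly_Mapping.single s c) = Poly_Mapping.single (r + s) (cpair u s * c)"
  by (simp add: vf_apply_def vf_D_def mult_single cpair_def sum_distrib_right mult.assoc single_sum)

lemma vf_bracket_D: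
  "vf_bracket (vf_D u r) (vf_D v s) = vf_D (cpair u s *\<^sub>C v - cpair v r *\<^sub>C u) (r + s)"
proof -
  have "vf_D u r $ i = Poly_Mapping.single r (u $ i)" for u r and i :: 'a
    by (simp add: vf_D_def)
  then show ?thesis
    by (simp add: vf_bracket_def vec_eq_iff vf_apply_D scaleC_complex_def
        single_diff add.commute)
qed

lemma cpair_add_left: "cpair (u + v) r = cpair u r + cpair v r"
  and cpair_diff_left: "cpair (u - v) r = cpair u r - cpair v r"
  and cpair_scaleC_left: "cpair (a *\<^sub>C u) r = a * cpair u r"
  and cpair_add_right: "cpair u (r + s) = cpair u r + cpair u s"
  by (simp_all add: cpair_def algebra_simps sum.distrib sum_subtractf sum_distrib_left
      scaleC_complex_def)

lemma csubspace_S_N: "csubspace S_N"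
  unfolding S_N_def by (rule complex_vector.subspace_span)

lemmas S_N_closed = complex_vector.subspace_0[OF csubspace_S_N]
  complex_vector.subspace_add[OF csubspace_S_N] complex_vector.subspace_diff[OF csubspace_S_N]
  complex_vector.subspace_neg[OF csubspace_S_N] complex_vector.subspace_scale[OF csubspace_S_N]

lemma vf_bracket_add_left: "vf_bracket (X + Y) Z = vf_bracket X Z + vf_bracket Y Z"
  and vf_bracket_add_right: "vf_bracket Z (X + Y) = vf_bracket Z X + vf_bracket Z Y"
  and vf_bracket_scaleC_left: "vf_bracket (a *\<^sub>C X) Z = a *\<^sub>C vf_bracket X Z"
  and vf_bracket_scaleC_right: "vf_bracket Z (a *\<^sub>C X) = a *\<^sub>C vf_bracket Z X"
  by (simp_all add: vf_bracket_def vec_eq_iff vf_apply_add_left vf_apply_add_right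
      vf_apply_scaleC_left vf_apply_scaleC_right complex_vector.scale_right_diff_distrib)

lemma vf_bracket_S_N:
  assumes X: "X \<in> S_N" and Y: "Y \<in> S_N"
  shows "vf_bracket X Y \<in> S_N"
proof -
  have z: "vf_bracket X 0 = 0" "vf_bracket 0 X = 0" for X :: "'a laurent ^ 'a"
    using vf_bracket_scaleC_right[of X 0 0] vf_bracket_scaleC_left[of 0 0 X] by simp_all
  show ?thesis
    using X unfolding S_N_def
  proof (induction rule: complex_vector.span_induct)
    case base
    show ?case
      by (simp add: complex_vector.subspace_def vf_bracket_add_left vf_bracket_scaleC_left z
          S_N_closed flip: S_N_def)
  next
    case (step X)
    then obtain u r where X: "X = vf_D u r" and u: "cpair u r = 0" by blast
    show ?case
      using Y unfolding S_N_def
    proof (induction rule: complex_vector.span_induct)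
      case base
      show ?case
        by (simp add: complex_vector.subspace_def vf_bracket_add_right vf_bracket_scaleC_right z
            S_N_closed flip: S_N_def)
    next
      case (step Y)
      then obtain v s where Y: "Y = vf_D v s" and v: "cpair v s = 0" by blast
      have "cpair (cpair u s *\<^sub>C v - cpair v r *\<^sub>C u) (r + s) = 0"
        by (simp add: cpair_diff_left cpair_scaleC_left cpair_add_right u v)
      then show ?case
        unfolding X Y vf_bracket_D by (intro complex_vector.span_base) blast
    qed
  qed
qed

text \<open>The semidirect product of \<^const>\<open>S_N\<close> with the abelian ideal of Laurent polynomials.\<close>

typedef (overloaded) ('n::finite) sna = "(S_N :: ('n laurent ^ 'n) set) \<times> (UNIV :: 'n laurent set)"
  using S_N_closed(1) by blast

setup_lifting type_definition_sna

instantiation sna :: (finite) complex_lie_algebra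
begin

lift_definition zero_sna :: "'a sna" is 0
  by (simp add: zero_prod_def S_N_closed)

lift_definition plus_sna :: "'a sna \<Rightarrow> 'a sna \<Rightarrow> 'a sna" is "(+)"
  by (auto intro: S_N_closed)

lift_definition minus_sna :: "'a sna \<Rightarrow> 'a sna \<Rightarrow> 'a sna" is "(-)"
  by (auto intro: S_N_closed)

lift_definition uminus_sna :: "'a sna \<Rightarrow> 'a sna" is uminus
  by (auto intro: S_N_closed)

lift_definition scaleC_sna :: "complex \<Rightarrow> 'a sna \<Rightarrow> 'a sna" is scaleC
  by (auto simp: scaleC_prod_def intro: S_N_closed)

lift_definition lie_sna :: "'a sna \<Rightarrow> 'a sna \<Rightarrow> 'a sna"
  is "\<lambda>(X, f) (Y, g). (vf_bracket X Y, vf_apply X g - vf_apply Y f)"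
  by (auto intro: vf_bracket_S_N)

instance
proof
  fix x y z :: "'a sna" and a b :: complex
  show "x + y + z = x + (y + z)" by transfer (simp add: add.assoc)
  show "x + y = y + x" by transfer (simp add: add.commute)
  show "0 + x = x" by transfer simp
  show "- x + x = 0" by transfer simp
  show "x - y = x + - y" by transfer simp
  show "a *\<^sub>C (x + y) = a *\<^sub>C x + a *\<^sub>C y" by transfer (simp add: scaleC_add_right)
  show "(a + b) *\<^sub>C x = a *\<^sub>C x + b *\<^sub>C x" by transfer (simp add: scaleC_add_left)
  show "a *\<^sub>C b *\<^sub>C x = (a * b) *\<^sub>C x" by transfer simp
  show "1 *\<^sub>C x = x" by transfer simp
  show "lie (x + y) z = lie x z + lie y z"
    by transfer (auto simp: vf_bracket_add_left vf_apply_add_left vf_apply_add_right)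
  show "lie x (y + z) = lie x y + lie x z"
    by transfer (auto simp: vf_bracket_add_right vf_apply_add_left vf_apply_add_right)
  show "lie (a *\<^sub>C x) y = a *\<^sub>C lie x y"
    by transfer (auto simp: scaleC_prod_def vf_bracket_scaleC_left vf_apply_scaleC_left
        vf_apply_scaleC_right complex_vector.scale_right_diff_distrib)
  show "lie x (a *\<^sub>C y) = a *\<^sub>C lie x y"
    by transfer (auto simp: scaleC_prod_def vf_bracket_scaleC_right vf_apply_scaleC_left
        vf_apply_scaleC_right complex_vector.scale_right_diff_distrib)
  show "lie x x = 0"
    by transfer (auto simp: vf_bracket_def vec_eq_iff zero_prod_def)
  show "lie x (lie y z) + lie y (lie z x) + lie z (lie x y) = 0"
  proof -
    have "vf_bracket X (vf_bracket Y Z) + vf_bracket Y (vf_bracket Z X) + vf_bracket Z (vf_bracket X Y) = 0"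
      for X Y Z :: "'a laurent ^ 'a"
    proof -
      have nth: "vf_bracket X Y $ i = vf_apply X (Y $ i) - vf_apply Y (X $ i)" for X Y :: "'a laurent ^ 'a" and i
        by (simp add: vf_bracket_def)
      show ?thesis
        unfolding vec_eq_iff by (simp add: nth vf_apply_bracket vf_apply_diff_right)
    qed
    then show ?thesis
      by transfer (simp add: split_beta zero_prod_def vf_apply_bracket vf_apply_diff_right)
  qed
qed

end

text \<open>\<open>sna_d i\<close> is \<open>t\<^sub>i d/dt\<^sub>i\<close> and \<open>sna_t r\<close> is the monomial with exponent \<open>r\<close>.\<close>

lift_definition sna_d :: "'n::finite \<Rightarrow> 'n sna" is "\<lambda>i. (vf_D (axis i 1) 0, 0)"
proof -
  fix i :: 'n
  have "cpair (axis i 1) 0 = 0" by (simp add: cpair_def)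
  then show "(vf_D (axis i 1) 0, 0) \<in> S_N \<times> (UNIV :: 'n laurent set)"
    unfolding S_N_def by (auto intro!: complex_vector.span_base)
qed

lift_definition sna_t :: "int ^ 'n::finite \<Rightarrow> 'n sna" is "\<lambda>r. (0, Poly_Mapping.single r 1)"
  by (simp add: S_N_closed)


section \<open>Weight modules\<close>

definition lie_module :: "('g::complex_lie_algebra \<Rightarrow> 'v::complex_vector \<Rightarrow> 'v) \<Rightarrow> bool" where
  "lie_module \<rho> \<longleftrightarrow> cbilinear \<rho> \<and> (\<forall>x y v. \<rho> (lie x y) v = \<rho> x (\<rho> y v) - \<rho> y (\<rho> x v))"

definition irreducible_module :: "('g::complex_lie_algebra \<Rightarrow> 'v::complex_vector \<Rightarrow> 'v) \<Rightarrow> bool" where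
  "irreducible_module \<rho> \<longleftrightarrow> lie_module \<rho> \<and> (\<exists>v::'v. v \<noteq> 0) \<and>
     (\<forall>W. csubspace W \<and> (\<forall>x. \<forall>w\<in>W. \<rho> x w \<in> W) \<longrightarrow> W = {0} \<or> W = UNIV)"

text \<open>A functional on a subspace \<open>H\<close> is represented by its extension by zero outside of \<open>H\<close>, so
  that equal functionals are equal functions.\<close>

definition dual_space :: "'g::complex_vector set \<Rightarrow> ('g \<Rightarrow> complex) set" where
  "dual_space H = {\<mu>. (\<forall>x\<in>H. \<forall>y\<in>H. \<mu> (x + y) = \<mu> x + \<mu> y) \<and>
     (\<forall>a. \<forall>x\<in>H. \<mu> (a *\<^sub>C x) = a * \<mu> x) \<and> (\<forall>x. x \<notin> H \<longrightarrow> \<mu> x = 0)}"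

definition weight_space ::
  "('g::complex_vector \<Rightarrow> 'v::complex_vector \<Rightarrow> 'v) \<Rightarrow> 'g set \<Rightarrow> ('g \<Rightarrow> complex) \<Rightarrow> 'v set" where
  "weight_space \<rho> H \<mu> = {v. \<forall>h\<in>H. \<rho> h v = \<mu> h *\<^sub>C v}"

text \<open>The whole space is the direct sum of the weight spaces.\<close>

definition weight_module ::
  "('g::complex_vector \<Rightarrow> 'v::complex_vector \<Rightarrow> 'v) \<Rightarrow> 'g set \<Rightarrow> bool" where
  "weight_module \<rho> H \<longleftrightarrow>
     (\<forall>v. \<exists>!w. (\<forall>\<mu>\<in>dual_space H. w \<mu> \<in> weight_space \<rho> H \<mu>) \<and> (\<forall>\<mu>. \<mu> \<notin> dual_space H \<longrightarrow> w \<mu> = 0) \<and>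
        finite {\<mu>. w \<mu> \<noteq> 0} \<and> v = (\<Sum>\<mu> | w \<mu> \<noteq> 0. w \<mu>))"

definition uniformly_bounded_weight_module ::
  "('g::complex_vector \<Rightarrow> 'v::complex_vector \<Rightarrow> 'v) \<Rightarrow> 'g set \<Rightarrow> bool" where
  "uniformly_bounded_weight_module \<rho> H \<longleftrightarrow> weight_module \<rho> H \<and>
     (\<exists>M>0. \<forall>\<mu>\<in>dual_space H. \<exists>S. finite S \<and> card S \<le> M \<and> \<not> cdependent S \<and>
        cspan S = weight_space \<rho> H \<mu>)"

definition cartan :: "('n::finite sna, 'b::complex_comm_algebra_1) tensor set" where
  "cartan = cspan (range (\<lambda>i. sna_d i \<otimes> 1))"

end

theory Submission
  imports Defs "HOL-Library.Multiset" "HOL-Computational_Algebra.Fundamental_Theorem_Algebra"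
begin

text \<open>
  Write \<open>T r b\<close> for the action of \<open>t\<^sup>r b\<close>. These operators commute, and bracketing with
  \<open>D(u, s) c\<close> acts on them as a derivation, sending \<open>T r b\<close> to \<open>(u|r) T (r + s) (b c)\<close>. The idea is to
  find, for each \<open>b\<close>, a scalar \<open>a\<close> such that \<open>T q ((b - a) c) = 0\<close> for all nonzero \<open>q\<close> and all \<open>c\<close>; the
  map \<open>b \<mapsto> a\<close> is then the required homomorphism.

  Take \<open>r = e\<^sub>i + e\<^sub>j\<close> with \<open>i \<noteq> j\<close>. The products \<open>X = T r 1 T (-r) 1\<close> and \<open>Y = T r b T (-r) 1\<close>
  preserve the finite-dimensional weight spaces. If \<open>X\<close> is injective, then some \<open>Y - a X\<close>, that is,
  \<open>T r (b - a) T (-r) 1\<close>, kills a nonzero vector, because a homogeneous relation among the vectors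
  \<open>X\<^sup>n\<^sup>-\<^sup>k Y\<^sup>k v\<close> splits into linear factors (\<open>pencil_kernel\<close>). Both the injectivity of \<open>X\<close> and the
  conclusion thus follow from one claim (\<open>pair_kills_imp_zero\<close>): if \<open>Z = T r b T (-r) 1\<close> kills a
  nonzero vector, then \<open>T q (b c) = 0\<close> for all nonzero \<open>q\<close> and all \<open>c\<close>.

  To prove the claim, note that the vectors killed by some power of \<open>Z\<close> form a submodule, so \<open>Z\<close> is
  locally nilpotent, and the bound on the dimensions of the weight spaces gives \<open>Z\<^sup>M = 0\<close> for a single
  \<open>M\<close>. Differentiating a relation \<open>x\<^sup>n z = 0\<close> between monomials shows that any \<open>2 n\<close> derivatives of
  \<open>x\<close> multiplied by \<open>z\<^sup>n\<^sup>+\<^sup>1\<close> give \<open>0\<close> (\<open>vanishes_all_derivatives\<close>). Applied to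
  \<open>(T r b)\<^sup>M (T (-r) 1)\<^sup>M = 0\<close>, first with \<open>x = T r b\<close> and then with \<open>x = T (-r) 1\<close>, this shows that
  \<open>T e\<^sub>i b\<close> and \<open>T e\<^sub>j b\<close> are nilpotent; applied to their powers, it shows that all
  sufficiently long products of operators \<open>T q (b c)\<close> with \<open>q \<noteq> 0\<close> vanish. Hence some nonzero vector is
  killed by all \<open>T q (b c)\<close> with \<open>q \<noteq> 0\<close>, and since the vectors with this property form a submodule,
  every vector is.
\<close>

section \<open>Linear algebra\<close>

lemma linear_relation_of_bounded_dimension:
  fixes f :: "nat \<Rightarrow> 'v::complex_vector"
  assumes S: "finite S" "card S \<le> M" and f: "\<And>i. f i \<in> cspan S"
  shows "\<exists>c. (\<exists>i\<le>M. c i \<noteq> 0) \<and> (\<Sum>i\<le>M. c i *\<^sub>C f i) = 0"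
proof (cases "inj_on f {..M}")
  case True
  have "cdependent (f ` {..M})"
  proof (rule ccontr)
    assume "\<not> cdependent (f ` {..M})"
    then have "card (f ` {..M}) \<le> card S"
      using complex_vector.independent_span_bound[OF S(1)] f by blast
    then show False using card_image[OF True] S(2) by simp
  qed
  then obtain g where g: "\<exists>v\<in>f ` {..M}. g v \<noteq> 0" "(\<Sum>v\<in>f ` {..M}. g v *\<^sub>C v) = 0"
    by (auto simp: complex_vector.dependent_finite)
  have "(\<Sum>i\<le>M. g (f i) *\<^sub>C f i) = 0"
    using g(2) by (simp add: sum.reindex[OF True])
  then show ?thesis using g(1) by (intro exI[of _ "g \<circ> f"]) auto
next
  case False
  then obtain i j where ij: "i \<le> M" "j \<le> M" "i \<noteq> j" "f i = f j"
    by (auto simp: inj_on_def)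
  define c :: "nat \<Rightarrow> complex" where "c k = (if k = i then 1 else if k = j then - 1 else 0)" for k
  have "(\<Sum>k\<le>M. c k *\<^sub>C f k) = (\<Sum>k\<in>{i, j}. c k *\<^sub>C f k)"
    by (rule sum.mono_neutral_right) (use ij in \<open>auto simp: c_def\<close>)
  also have "\<dots> = 0" using ij by (simp add: c_def)
  finally show ?thesis using ij(1) by (intro exI[of _ c]) (auto simp: c_def)
qed

lemma funpow_linear:
  fixes Z :: "'v::complex_vector \<Rightarrow> 'v"
  assumes "\<And>v w. Z (v + w) = Z v + Z w" "\<And>a v. Z (a *\<^sub>C v) = a *\<^sub>C Z v"
  shows "(Z ^^ n) (v + w) = (Z ^^ n) v + (Z ^^ n) w" "(Z ^^ n) (a *\<^sub>C v) = a *\<^sub>C (Z ^^ n) v"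
  by (induction n) (simp_all add: assms)

lemma scaleC_linear_zero:
  fixes Z :: "'v::complex_vector \<Rightarrow> 'w::complex_vector"
  assumes "\<And>a v. Z (a *\<^sub>C v) = a *\<^sub>C Z v"
  shows "Z 0 = 0"
  using assms[of 0 0] by simp

lemma scaleC_linear_sum:
  fixes Z :: "'v::complex_vector \<Rightarrow> 'w::complex_vector"
  assumes "\<And>v w. Z (v + w) = Z v + Z w" "\<And>a v. Z (a *\<^sub>C v) = a *\<^sub>C Z v"
  shows "Z (\<Sum>i\<in>A. f i) = (\<Sum>i\<in>A. Z (f i))"
  by (induction A rule: infinite_finite_induct) (simp_all add: assms scaleC_linear_zero)

lemma funpow_zero_mono:
  fixes Z :: "'v::complex_vector \<Rightarrow> 'v"
  assumes Z0: "Z 0 = 0" and "(Z ^^ k) v = 0" "k \<le> l"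
  shows "(Z ^^ l) v = 0"
proof -
  have z: "(Z ^^ n) 0 = 0" for n by (induction n) (simp_all add: Z0)
  have "(Z ^^ l) v = (Z ^^ (l - k)) ((Z ^^ k) v)"
    using \<open>k \<le> l\<close> by (metis comp_apply funpow_add le_add_diff_inverse2)
  then show ?thesis using assms(2) z by simp
qed

lemma nilpotent_bound:
  fixes Z :: "'v::complex_vector \<Rightarrow> 'v"
  assumes lin: "\<And>v w. Z (v + w) = Z v + Z w" "\<And>a v. Z (a *\<^sub>C v) = a *\<^sub>C Z v"
    and S: "finite S" "card S \<le> M" and in_span: "\<And>i. (Z ^^ i) v \<in> cspan S"
    and nil: "(Z ^^ k) v = 0"
  shows "(Z ^^ M) v = 0"
proof (rule ccontr)
  assume nz: "(Z ^^ M) v \<noteq> 0"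
  define k0 where "k0 = (LEAST k. (Z ^^ k) v = 0)"
  have k0: "(Z ^^ k0) v = 0" unfolding k0_def using nil by (rule LeastI)
  have below: "(Z ^^ l) v \<noteq> 0" if "l < k0" for l
    using not_less_Least that unfolding k0_def by blast
  note Z0 = scaleC_linear_zero[of Z, OF lin(2)]
  have "M < k0" using nz funpow_zero_mono[OF Z0 k0, of M] by (cases "k0 \<le> M") auto
  obtain c where c: "\<exists>i\<le>M. c i \<noteq> 0" "(\<Sum>i\<le>M. c i *\<^sub>C (Z ^^ i) v) = 0"
    using linear_relation_of_bounded_dimension[of S M "\<lambda>i. (Z ^^ i) v", OF S in_span] by auto
  define i0 where "i0 = (LEAST i. c i \<noteq> 0)"
  obtain i1 where i1: "i1 \<le> M" "c i1 \<noteq> 0" using c(1) by blast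
  have i0: "c i0 \<noteq> 0" unfolding i0_def using i1(2) by (rule LeastI)
  have "i0 \<le> i1" unfolding i0_def using i1(2) by (rule Least_le)
  then have "i0 \<le> M" using i1(1) by simp
  have c_below: "c i = 0" if "i < i0" for i
    using not_less_Least[of i "\<lambda>i. c i \<noteq> 0"] that unfolding i0_def by blast
  define l where "l = k0 - 1 - i0"
  \<comment> \<open>Applying this power kills every term of the relation beyond its first nonzero one.\<close>
  have "0 = (Z ^^ l) (\<Sum>i\<le>M. c i *\<^sub>C (Z ^^ i) v)"
    by (simp add: c(2) scaleC_linear_zero[of "Z ^^ l", OF funpow_linear(2)[of Z, OF lin]])
  also have "\<dots> = (\<Sum>i\<le>M. c i *\<^sub>C (Z ^^ (l + i)) v)"
    by (simp add: scaleC_linear_sum[of "Z ^^ l", OF funpow_linear[of Z, OF lin]]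
        funpow_linear(2)[of Z, OF lin] funpow_add)
  also have "\<dots> = (\<Sum>i\<in>{i0}. c i *\<^sub>C (Z ^^ (l + i)) v)"
  proof (rule sum.mono_neutral_right)
    show "\<forall>i\<in>{..M} - {i0}. c i *\<^sub>C (Z ^^ (l + i)) v = 0"
    proof
      fix i assume "i \<in> {..M} - {i0}"
      then consider "i < i0" | "i > i0" by force
      then show "c i *\<^sub>C (Z ^^ (l + i)) v = 0"
      proof cases
        case 2
        then have "k0 \<le> l + i" using \<open>M < k0\<close> \<open>i0 \<le> M\<close> by (simp add: l_def)
        then show ?thesis using funpow_zero_mono[OF Z0 k0] by simp
      qed (simp add: c_below)
    qed
  qed (use \<open>i0 \<le> M\<close> in auto)
  finally have "(Z ^^ (l + i0)) v = 0" using i0 by simp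
  then show False using below[of "l + i0"] \<open>M < k0\<close> \<open>i0 \<le> M\<close> by (simp add: l_def)
qed

text \<open>A homogeneous relation between \<open>X\<close> and \<open>Y\<close> at \<open>v\<close> splits into linear factors over the complex
  numbers, so that some \<open>Y - a X\<close> is not injective.\<close>

lemma pencil_kernel:
  fixes X Y :: "'v::complex_vector \<Rightarrow> 'v"
  assumes X: "\<And>v w. X (v + w) = X v + X w" "\<And>a v. X (a *\<^sub>C v) = a *\<^sub>C X v"
    and Y: "\<And>v w. Y (v + w) = Y v + Y w" "\<And>a v. Y (a *\<^sub>C v) = a *\<^sub>C Y v"
    and comm: "\<And>v. X (Y v) = Y (X v)" and inj: "\<And>v. X v = 0 \<Longrightarrow> v = 0"
    and "p \<noteq> 0" "degree p \<le> n" "v \<noteq> 0"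
    and "(\<Sum>i\<le>n. coeff p i *\<^sub>C (X ^^ (n - i)) ((Y ^^ i) v)) = 0"
  shows "\<exists>a w. w \<noteq> 0 \<and> Y w = a *\<^sub>C X w"
  using assms(7-)
proof (induction n arbitrary: p)
  case 0
  then have "coeff p 0 \<noteq> 0" using leading_coeff_neq_0[of p] by simp
  then show ?case using 0 by simp
next
  case (Suc n)
  note X0 = scaleC_linear_zero[of X, OF X(2)]
  have YX: "Y ((X ^^ k) w) = (X ^^ k) (Y w)" for k w
    by (induction k) (simp_all add: comm[symmetric])
  show ?case
  proof (cases "degree p = 0")
    case True
    then have c: "coeff p i = 0" if "i > 0" for i using that by (simp add: coeff_eq_0)
    have "coeff p 0 *\<^sub>C (X ^^ Suc n) v = (\<Sum>i\<in>{0}. coeff p i *\<^sub>C (X ^^ (Suc n - i)) ((Y ^^ i) v))"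
      by simp
    also have "\<dots> = (\<Sum>i\<le>Suc n. coeff p i *\<^sub>C (X ^^ (Suc n - i)) ((Y ^^ i) v))"
      by (rule sum.mono_neutral_left) (auto simp: c)
    finally have "(X ^^ Suc n) v = 0"
      using Suc.prems True leading_coeff_neq_0[of p] by simp
    moreover have "(X ^^ k) v \<noteq> 0" for k
      by (induction k) (use inj \<open>v \<noteq> 0\<close> in auto)
    ultimately show ?thesis by blast
  next
    case False
    then obtain a where "poly p a = 0"
      using fundamental_theorem_of_algebra[of p] by (auto simp: constant_degree)
    then obtain q where p: "p = [:- a, 1:] * q" by (auto simp: poly_eq_0_iff_dvd elim: dvdE)
    have "q \<noteq> 0" using \<open>p \<noteq> 0\<close> p by auto
    have "degree p = Suc (degree q)"
      unfolding p using \<open>q \<noteq> 0\<close> by (subst degree_mult_eq) auto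
    then have dq: "degree q \<le> n" using Suc.prems by simp
    define w where "w = (\<Sum>i\<le>n. coeff q i *\<^sub>C (X ^^ (n - i)) ((Y ^^ i) v))"
    define g where "g i = (X ^^ (Suc n - i)) ((Y ^^ i) v)" for i
    have Xw: "X w = (\<Sum>i\<le>n. coeff q i *\<^sub>C g i)"
      unfolding w_def g_def
      by (simp add: scaleC_linear_sum[of X, OF X] X(2) Suc_diff_le)
    have Yw: "Y w = (\<Sum>i\<le>n. coeff q i *\<^sub>C g (Suc i))"
      unfolding w_def g_def by (simp add: scaleC_linear_sum[of Y, OF Y] Y(2) YX)
    have cp: "coeff p i = (if i = 0 then 0 else coeff q (i - 1)) - a * coeff q i" for i
      unfolding p by (cases i) (simp_all add: coeff_pCons)
    have "0 = (\<Sum>i\<le>Suc n. coeff p i *\<^sub>C g i)"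
      using Suc.prems by (simp add: g_def)
    also have "\<dots> = (\<Sum>i\<le>Suc n. (if i = 0 then 0 else coeff q (i - 1)) *\<^sub>C g i)
        - (\<Sum>i\<le>Suc n. (a * coeff q i) *\<^sub>C g i)"
      by (simp only: cp complex_vector.scale_left_diff_distrib sum_subtractf)
    also have "(\<Sum>i\<le>Suc n. (if i = 0 then 0 else coeff q (i - 1)) *\<^sub>C g i) = Y w"
      unfolding Yw by (simp add: sum.atMost_Suc_shift del: sum.atMost_Suc)
    also have "(\<Sum>i\<le>Suc n. (a * coeff q i) *\<^sub>C g i) = a *\<^sub>C X w"
      using dq by (simp add: Xw complex_vector.scale_sum_right coeff_eq_0)
    finally have YX_w: "Y w = a *\<^sub>C X w" by simp
    show ?thesis
    proof (cases "w = 0")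
      case True
      then show ?thesis
        using Suc.IH[OF \<open>q \<noteq> 0\<close> dq \<open>v \<noteq> 0\<close>] unfolding w_def by blast
    qed (use YX_w in blast)
  qed
qed

section \<open>Generators and brackets\<close>

text \<open>The field \<open>D(u, s)\<close>, which is divergence-free only for \<open>u\<close> orthogonal to \<open>s\<close>; otherwise the value
  is \<open>0\<close>.\<close>

lift_definition sna_D :: "complex ^ 'n::finite \<Rightarrow> int ^ 'n \<Rightarrow> 'n sna"
  is "\<lambda>u s. (if cpair u s = 0 then vf_D u s else 0, 0)"
proof -
  fix u and s :: "int ^ 'n"
  have "vf_D u s \<in> S_N" if "cpair u s = 0"
    unfolding S_N_def using that by (intro complex_vector.span_base) blast
  then show "(if cpair u s = 0 then vf_D u s else 0, 0) \<in> S_N \<times> (UNIV :: 'n laurent set)"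
    by (simp add: S_N_closed)
qed

lemma sna_d_eq: "sna_d i = sna_D (axis i 1) 0"
  by transfer (simp add: cpair_def)

lemma cpair_axis: "cpair (axis i 1) r = of_int (r $ i)"
  unfolding cpair_def by (subst sum.remove[of _ i]) (auto simp: axis_def intro!: sum.neutral)

lemma cpair_diff_right: "cpair u (r - s) = cpair u r - cpair u s"
  and cpair_minus_right: "cpair u (- r) = - cpair u r"
  by (simp_all add: cpair_def algebra_simps sum_subtractf sum_negf)

lemma lie_sna_t_t: "lie (sna_t r) (sna_t s) = 0"
  by transfer (simp add: vf_bracket_def vf_apply_def zero_prod_def vec_eq_iff)

lemma lie_sna_D_t:
  assumes "cpair u s = 0"
  shows "lie (sna_D u s) (sna_t r) = cpair u r *\<^sub>C sna_t (r + s)"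
proof -
  have "euler i 0 = 0" for i :: 'a
    using euler_single[of i 0 0] by simp
  then have "vf_apply X 0 = 0" "vf_apply 0 f = 0" for X :: "'a laurent ^ 'a" and f
    by (simp_all add: vf_apply_def)
  note [simp] = this
  show ?thesis
    using assms
    by transfer (simp add: vf_bracket_def vf_apply_D scaleC_prod_def vec_eq_iff scaleC_single
        scaleC_complex_def add.commute)
qed

lemma sna_generated:
  assumes P: "csubspace P" and D: "\<And>u s. cpair u s = 0 \<Longrightarrow> sna_D u s \<in> P" and t: "\<And>r. sna_t r \<in> P"
  shows "(x :: 'n::finite sna) \<in> P"
proof -
  note P_closed = complex_vector.subspace_0[OF P] complex_vector.subspace_add[OF P]
    complex_vector.subspace_scale[OF P]
  have S: "X \<in> S_N \<and> Abs_sna (X, 0) \<in> P" if "X \<in> S_N" for X :: "'n laurent ^ 'n"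
    using that unfolding S_N_def
  proof (induction rule: complex_vector.span_induct)
    case base
    have "Abs_sna (0 :: 'n laurent ^ 'n, 0 :: 'n laurent) = 0" by (simp add: zero_sna_def zero_prod_def)
    moreover have "Abs_sna (X + Y, 0 :: 'n laurent) = Abs_sna (X, 0) + Abs_sna (Y, 0)"
      if "X \<in> S_N" "Y \<in> S_N" for X Y :: "'n laurent ^ 'n"
      using that by (subst plus_sna.abs_eq) (auto simp: eq_onp_def)
    moreover have "Abs_sna (a *\<^sub>C X, 0 :: 'n laurent) = a *\<^sub>C Abs_sna (X, 0)"
      if "X \<in> S_N" for X :: "'n laurent ^ 'n" and a
      using that by (subst scaleC_sna.abs_eq) (auto simp: eq_onp_def scaleC_prod_def)
    ultimately show ?case
      unfolding S_N_def[symmetric] complex_vector.subspace_def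
      by (auto simp: S_N_closed P_closed)
  next
    case (step X)
    then obtain u r where X: "X = vf_D u r" and u: "cpair u r = 0" by blast
    have "Abs_sna (X, 0) = sna_D u r" using u by (simp add: sna_D_def X)
    moreover have "X \<in> S_N"
      using step unfolding S_N_def by (rule complex_vector.span_base)
    ultimately show ?case using D[OF u] by (simp add: S_N_def)
  qed
  have A: "Abs_sna (0, f) \<in> P" for f :: "'n laurent"
  proof (induction f rule: poly_mapping_single_induct)
    case (single k c)
    have "Abs_sna (0, Poly_Mapping.single k c) = c *\<^sub>C sna_t k"
      unfolding sna_t_def map_fun_apply id_apply
      by (subst scaleC_sna.abs_eq)
        (auto simp: eq_onp_def scaleC_prod_def S_N_closed scaleC_single scaleC_complex_def)
    then show ?case using t P_closed by simp
  next
    case (add p q)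
    have "Abs_sna (0, p + q) = Abs_sna (0, p) + Abs_sna (0, q)"
      by (subst plus_sna.abs_eq) (auto simp: eq_onp_def S_N_closed)
    then show ?case using add P_closed by simp
  qed
  obtain X f where Xf: "Rep_sna x = (X, f)" by force
  then have X: "X \<in> S_N" using Rep_sna[of x] by simp
  have "x = Abs_sna (X, f)" by (metis Xf Rep_sna_inverse)
  also have "\<dots> = Abs_sna (X, 0) + Abs_sna (0, f)"
    using X by (subst plus_sna.abs_eq) (auto simp: eq_onp_def S_N_closed)
  finally show ?thesis using S[OF X] A P_closed by simp
qed

text \<open>Exponents \<open>r\<close>, \<open>q\<close> with this property are exactly those for which some \<open>D(u, q - r)\<close> maps
  \<open>t\<^sup>r\<close> to a nonzero multiple of \<open>t\<^sup>q\<close>. It fails for distinct parallel exponents.\<close>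

definition linked :: "int ^ 'n::finite \<Rightarrow> int ^ 'n \<Rightarrow> bool" where
  "linked r q \<longleftrightarrow> (\<exists>u. cpair u q = cpair u r \<and> cpair u r \<noteq> 0)"

lemma linked_axis:
  assumes "k \<noteq> i" "q $ k \<noteq> 0"
  shows "linked (axis i 1) (q :: int ^ 'n::finite)"
proof -
  define u :: "complex ^ 'n" where
    "u = axis i 1 + ((1 - of_int (q $ i)) / of_int (q $ k)) *\<^sub>C axis k 1"
  have "cpair u q = 1" "cpair u (axis i 1) = 1"
    using assms by (simp_all add: u_def cpair_add_left cpair_scaleC_left cpair_axis)
      (simp_all add: axis_def)
  then show ?thesis unfolding linked_def by (metis zero_neq_one)
qed

lemma linked_sum_axis:
  assumes "i \<noteq> j"
  shows "linked (axis i 1 + axis j 1) (axis i 1 :: int ^ 'n::finite)"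
    and "linked (- (axis i 1 + axis j 1)) (axis i 1 :: int ^ 'n::finite)"
proof -
  have "cpair (axis i 1) (axis i 1 + axis j 1 :: int ^ 'n) = 1" "cpair (axis i 1) (axis i 1 :: int ^ 'n) = 1"
    using assms by (simp_all add: cpair_axis) (simp_all add: axis_def)
  then show "linked (axis i 1 + axis j 1) (axis i 1 :: int ^ 'n)"
    unfolding linked_def by (metis zero_neq_one)
  define u :: "complex ^ 'n" where "u = axis i 1 + (- 2) *\<^sub>C axis j 1"
  have "cpair u (- (axis i 1 + axis j 1)) = 1" "cpair u (axis i 1) = 1"
    using assms unfolding u_def
    by (simp_all only: cpair_add_left cpair_scaleC_left cpair_axis) (simp_all add: axis_def)
  then show "linked (- (axis i 1 + axis j 1)) (axis i 1 :: int ^ 'n)"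
    unfolding linked_def by (metis zero_neq_one)
qed

section \<open>Monomials in the Laurent operators\<close>

text \<open>A module for the Lie algebra \<open>(S\<^sub>N \<ltimes> A\<^sub>N) \<otimes> B\<close>.\<close>

locale sna_module =
  fixes \<rho> :: "('n::finite sna, 'b::complex_comm_algebra_1) tensor \<Rightarrow> 'v::complex_vector \<Rightarrow> 'v"
  assumes module: "lie_module \<rho>"
begin

text \<open>The operator by which \<open>t\<^sup>r b\<close> acts.\<close>

definition T :: "int ^ 'n \<Rightarrow> 'b \<Rightarrow> 'v \<Rightarrow> 'v" where
  "T r b = \<rho> (sna_t r \<otimes> b)"

lemma rho_add_left: "\<rho> (x + y) v = \<rho> x v + \<rho> y v"
  and rho_add_right: "\<rho> x (v + w) = \<rho> x v + \<rho> x w"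
  and rho_scaleC_left: "\<rho> (a *\<^sub>C x) v = a *\<^sub>C \<rho> x v"
  and rho_scaleC_right: "\<rho> x (a *\<^sub>C v) = a *\<^sub>C \<rho> x v"
  and rho_lie: "\<rho> (lie x y) v = \<rho> x (\<rho> y v) - \<rho> y (\<rho> x v)"
  using module by (simp_all add: lie_module_def cbilinear_def)

lemma rho_zero_left: "\<rho> 0 v = 0"
  using rho_scaleC_left[of 0 0 v] by simp

lemma T_add: "T r b (v + w) = T r b v + T r b w"
  and T_scaleC: "T r b (a *\<^sub>C v) = a *\<^sub>C T r b v"
  and T_add_coeff: "T r (b + c) v = T r b v + T r c v"
  and T_scaleC_coeff: "T r (a *\<^sub>C b) v = a *\<^sub>C T r b v"
  by (simp_all add: T_def rho_add_right rho_scaleC_right rho_add_left rho_scaleC_left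
      tensor_add_right tensor_scaleC_right)

lemma T_diff: "T r b (v - w) = T r b v - T r b w"
  using T_add[of r b "v - w" w] by simp

lemma T_zero: "T r b 0 = 0"
  using T_scaleC[of r b 0 0] by simp

lemma T_commute: "T r b (T s c v) = T s c (T r b v)"
proof -
  have "lie (sna_t r \<otimes> b) (sna_t s \<otimes> c) = 0"
    using tensor_scaleC_left[of 0 0] by (simp add: lie_pure_tensor lie_sna_t_t)
  then show ?thesis using rho_lie[of "sna_t r \<otimes> b" "sna_t s \<otimes> c" v] by (simp add: T_def rho_zero_left)
qed

lemma D_T:
  assumes "cpair u s = 0"
  shows "\<rho> (sna_D u s \<otimes> c) (T r b v) =
    T r b (\<rho> (sna_D u s \<otimes> c) v) + cpair u r *\<^sub>C T (r + s) (b * c) v"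
  using rho_lie[of "sna_D u s \<otimes> c" "sna_t r \<otimes> b" v]
  by (simp add: T_def lie_pure_tensor lie_sna_D_t[OF assms] tensor_scaleC_left rho_scaleC_left
      mult.commute algebra_simps)

text \<open>The product of the commuting operators \<open>T r b\<close> over a multiset of pairs \<open>(r, b)\<close>.\<close>

definition mon :: "((int ^ 'n) \<times> 'b) multiset \<Rightarrow> 'v \<Rightarrow> 'v" where
  "mon m v = fold_mset (\<lambda>a. T (fst a) (snd a)) v m"

text \<open>The product of operators indexed by \<open>m\<close> is zero on the whole module.\<close>

definition vanishes :: "((int ^ 'n) \<times> 'b) multiset \<Rightarrow> bool" where
  "vanishes m \<longleftrightarrow> (\<forall>v. mon m v = 0)"

sublocale T: comp_fun_commute "\<lambda>a. T (fst a) (snd a)"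
  by standard (simp add: fun_eq_iff T_commute)

lemma mon_empty [simp]: "mon {#} v = v"
  by (simp add: mon_def)

lemma mon_add_mset [simp]: "mon (add_mset a m) v = T (fst a) (snd a) (mon m v)"
  by (simp add: mon_def)

lemma mon_union: "mon (m + m') v = mon m (mon m' v)"
  by (induction m) simp_all

lemma mon_add: "mon m (v + w) = mon m v + mon m w"
  and mon_scaleC: "mon m (a *\<^sub>C v) = a *\<^sub>C mon m v"
  and mon_zero: "mon m 0 = 0"
  by (induction m) (simp_all add: T_add T_scaleC T_zero)

lemma mon_commute: "mon m (mon m' v) = mon m' (mon m v)"
  by (metis mon_union add.commute)

lemma mon_sum_mset: "mon m (\<Sum>a\<in>#k. f a) = (\<Sum>a\<in>#k. mon m (f a))"
  by (induction k) (simp_all add: mon_add mon_zero)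

lemma T_sum_mset: "T r b (\<Sum>a\<in>#k. f a) = (\<Sum>a\<in>#k. T r b (f a))"
  by (induction k) (simp_all add: T_add T_zero)

lemma mon_repeat: "mon (repeat_mset k m) v = (mon m ^^ k) v"
  by (induction k) (simp_all add: mon_union)

lemma vanishes_mono:
  assumes "vanishes m" "m \<subseteq># m'"
  shows "vanishes m'"
  using assms mon_union[of m "m' - m"] by (auto simp: vanishes_def)

text \<open>The Leibniz rule for the bracket of \<open>D(u, s) c\<close> with a product of operators.\<close>

lemma D_mon:
  assumes "cpair u s = 0"
  shows "\<rho> (sna_D u s \<otimes> c) (mon m v) = mon m (\<rho> (sna_D u s \<otimes> c) v) +
    (\<Sum>a\<in>#m. cpair u (fst a) *\<^sub>C mon (add_mset (fst a + s, snd a * c) (m - {#a#})) v)"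
proof (induction m)
  case (add x m)
  have "(\<Sum>a\<in>#m. cpair u (fst a) *\<^sub>C mon (add_mset (fst a + s, snd a * c) (add_mset x m - {#a#})) v)
      = (\<Sum>a\<in>#m. T (fst x) (snd x) (cpair u (fst a) *\<^sub>C mon (add_mset (fst a + s, snd a * c) (m - {#a#})) v))"
  proof (rule arg_cong[of _ _ sum_mset], rule image_mset_cong)
    fix a assume "a \<in># m"
    then have "add_mset x m - {#a#} = add_mset x (m - {#a#})"
      by (cases "a = x") simp_all
    then show "cpair u (fst a) *\<^sub>C mon (add_mset (fst a + s, snd a * c) (add_mset x m - {#a#})) v
      = T (fst x) (snd x) (cpair u (fst a) *\<^sub>C mon (add_mset (fst a + s, snd a * c) (m - {#a#})) v)"
      by (simp add: T_scaleC T_commute)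
  qed
  then show ?case
    by (simp only: mon_add_mset D_T[OF assms] add.IH T_add T_sum_mset) (simp add: algebra_simps)
qed simp

text \<open>One differentiation of a vanishing product \<open>x\<^sup>n\<^sup>+\<^sup>1 z\<close>: if a factor \<open>y\<close> takes care of the terms
  in which \<open>z\<close> is differentiated, then the term in which \<open>x\<close> is differentiated vanishes.\<close>

lemma vanishes_derivative:
  assumes van: "vanishes (replicate_mset (Suc n) (r, b) + z)"
    and u: "cpair u s = 0" "cpair u r \<noteq> 0"
    and y: "\<And>a. a \<in># z \<Longrightarrow> vanishes (replicate_mset (Suc n) (r, b) + (z - {#a#}) + y)"
  shows "vanishes (add_mset (r + s, b * c) (replicate_mset n (r, b) + z + y))"
  unfolding vanishes_def
proof
  fix v
  let ?x = "replicate_mset (Suc n) (r, b)"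
  let ?w = "mon y v"
  define F where "F a = cpair u (fst a) *\<^sub>C mon (add_mset (fst a + s, snd a * c) (?x + z - {#a#})) ?w" for a
  have D0: "\<rho> (sna_D u s \<otimes> c) 0 = 0"
    using rho_scaleC_right[of _ 0 0] by simp
  have sum0: "0 = (\<Sum>a\<in>#?x + z. F a)"
    using D_mon[OF u(1), of c "?x + z" ?w] van by (simp add: vanishes_def D0 F_def)
  have "F a = 0" if "a \<in># z" for a
  proof -
    have "?x + z - {#a#} = ?x + (z - {#a#})"
      using that by (metis multiset_diff_union_assoc single_subset_iff)
    moreover have "mon (?x + (z - {#a#})) ?w = 0"
      using y[OF that] by (simp only: mon_union[symmetric] vanishes_def)
    ultimately show ?thesis unfolding F_def by (simp only: mon_add_mset T_zero complex_vector.scale_zero_right)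
  qed
  then have z0: "(\<Sum>a\<in>#z. F a) = 0" by (simp cong: image_mset_cong)
  have rep: "sum_mset (replicate_mset k w) = of_nat k *\<^sub>C w" for k and w :: 'v
    by (induction k) (simp_all add: scaleC_add_left)
  have "of_nat (Suc n) *\<^sub>C F (r, b) = 0"
    using sum0 z0 rep[of "Suc n" "F (r, b)"] by (simp only: image_mset_union image_replicate_mset sum_mset.union add_0_right)
  moreover have "(of_nat (Suc n) :: complex) \<noteq> 0" by (rule of_nat_neq_0)
  ultimately have "F (r, b) = 0" by (metis complex_vector.scale_eq_0_iff)
  then have "mon (add_mset (r + s, b * c) (replicate_mset n (r, b) + z)) ?w = 0"
    using u(2) by (simp add: F_def)
  then show "mon (add_mset (r + s, b * c) (replicate_mset n (r, b) + z + y)) v = 0"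
    by (simp add: mon_union)
qed

text \<open>Pairs \<open>a\<close> with \<open>linked r (fst a)\<close> and \<open>b dvd snd a\<close> stand for the derivatives of \<open>T r b\<close>, up to
  nonzero scalars. In the induction step a relation with \<open>2 k\<close> derivatives is differentiated and then
  multiplied by one more derivative and by \<open>z\<close>: after that, each term in which a factor other than
  \<open>T r b\<close> is differentiated still contains a product that vanishes by the induction hypothesis.\<close>

lemma vanishes_derivatives:
  assumes van: "vanishes (replicate_mset n (r, b) + z)"
    and "k \<le> n" "size w = 2 * k" "\<And>a. a \<in># w \<Longrightarrow> linked r (fst a) \<and> b dvd snd a"
  shows "vanishes (replicate_mset (n - k) (r, b) + w + repeat_mset (Suc k) z)"
  using assms(2-)
proof (induction k arbitrary: w)
  case 0
  then show ?case using van by simp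
next
  case (Suc k)
  obtain e w1 where w1: "w = add_mset e w1" "size w1 = Suc (2 * k)"
    using Suc.prems(2) size_eq_Suc_imp_eq_union[of w "Suc (2 * k)"] by auto
  then obtain e' w' where "w1 = add_mset e' w'" "size w' = 2 * k"
    using size_eq_Suc_imp_eq_union[of w1 "2 * k"] by auto
  then have w: "w = add_mset e (add_mset e' w')" "size w' = 2 * k" using w1 by auto
  let ?x = "replicate_mset (n - k) (r, b)"
  have nk: "n - k = Suc (n - Suc k)" using Suc.prems(1) by simp
  have IH: "vanishes (?x + w'' + repeat_mset (Suc k) z)"
    if "w'' \<subseteq># add_mset e' w'" "size w'' = 2 * k" for w''
  proof (rule Suc.IH)
    show "linked r (fst a) \<and> b dvd snd a" if "a \<in># w''" for a
      using mset_subset_eqD[OF \<open>w'' \<subseteq># add_mset e' w'\<close> that] Suc.prems(3)[of a] w(1) by simp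
  qed (use that Suc.prems in simp_all)
  obtain u where u: "cpair u (fst e) = cpair u r" "cpair u r \<noteq> 0"
    using Suc.prems(3)[of e] w(1) by (auto simp: linked_def)
  obtain c where c: "snd e = b * c" using Suc.prems(3)[of e] w(1) by (auto elim: dvdE)
  have "vanishes (add_mset (r + (fst e - r), b * c)
      (replicate_mset (n - Suc k) (r, b) + (w' + repeat_mset (Suc k) z) + ({#e'#} + z)))"
  proof (rule vanishes_derivative)
    show "vanishes (replicate_mset (Suc (n - Suc k)) (r, b) + (w' + repeat_mset (Suc k) z))"
      using IH[of w'] w(2) by (simp add: add.assoc flip: nk)
    show "cpair u (fst e - r) = 0" "cpair u r \<noteq> 0" using u by (simp_all add: cpair_diff_right)
    fix a assume "a \<in># w' + repeat_mset (Suc k) z"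
    then consider "a \<in># w'" | "a \<in># z" by (auto simp flip: count_greater_zero_iff)
    then have "vanishes (?x + ((w' + repeat_mset (Suc k) z) - {#a#}) + ({#e'#} + z))"
    proof cases
      case 1
      then have "size (add_mset e' (w' - {#a#})) = 2 * k"
        using w(2) by (simp add: size_Suc_Diff1)
      then have "vanishes (?x + add_mset e' (w' - {#a#}) + repeat_mset (Suc k) z)"
        by (intro IH) simp_all
      then show ?thesis
        by (rule vanishes_mono) (use 1 in \<open>auto simp: subseteq_mset_def\<close>)
    next
      case 2
      have "vanishes (?x + w' + repeat_mset (Suc k) z)" using w(2) by (intro IH) simp_all
      then show ?thesis
        by (rule vanishes_mono) (use 2 in \<open>auto simp: subseteq_mset_def dest!: multi_member_split\<close>)
    qed
    then show "vanishes (replicate_mset (Suc (n - Suc k)) (r, b) +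
        ((w' + repeat_mset (Suc k) z) - {#a#}) + ({#e'#} + z))"
      by (simp add: nk)
  qed
  moreover have "add_mset (r + (fst e - r), b * c)
      (replicate_mset (n - Suc k) (r, b) + (w' + repeat_mset (Suc k) z) + ({#e'#} + z))
    = replicate_mset (n - Suc k) (r, b) + w + repeat_mset (Suc (Suc k)) z"
  proof -
    have "(r + (fst e - r), b * c) = e" using c by (simp add: prod_eq_iff)
    then show ?thesis by (simp add: w(1) ac_simps)
  qed
  ultimately show ?case by (simp only:)
qed

corollary vanishes_all_derivatives:
  assumes "vanishes (replicate_mset n (r, b) + z)"
    and "size w = 2 * n" "\<And>a. a \<in># w \<Longrightarrow> linked r (fst a) \<and> b dvd snd a"
  shows "vanishes (w + repeat_mset (Suc n) z)"
  using vanishes_derivatives[of n r b z n w] assms by simp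

end

section \<open>Irreducible bounded modules\<close>

text \<open>Irreducible uniformly bounded weight modules, for a torus of rank at least \<open>2\<close>.\<close>

locale bounded_irreducible_sna_module = sna_module \<rho>
  for \<rho> :: "('n::finite sna, 'b::complex_comm_algebra_1) tensor \<Rightarrow> 'v::complex_vector \<Rightarrow> 'v" +
  assumes irreducible: "irreducible_module \<rho>"
    and bounded: "uniformly_bounded_weight_module \<rho> cartan"
    and rank: "CARD('n) \<ge> 2"
begin

text \<open>A subspace that contains a nonzero vector and is stable under the generators is the whole module.\<close>

lemma submodule_trivial:
  assumes W: "csubspace W"
    and D: "\<And>u s c w. cpair u s = 0 \<Longrightarrow> w \<in> W \<Longrightarrow> \<rho> (sna_D u s \<otimes> c) w \<in> W"
    and t: "\<And>r c w. w \<in> W \<Longrightarrow> T r c w \<in> W"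
    and "w0 \<in> W" "w0 \<noteq> 0"
  shows "v \<in> W"
proof -
  note W_closed = complex_vector.subspace_0[OF W] complex_vector.subspace_add[OF W]
    complex_vector.subspace_scale[OF W]
  have "\<forall>w\<in>W. \<rho> x w \<in> W" for x
  proof (induction x rule: tensor_induct)
    case (pure x b)
    have "x \<in> {x. \<forall>w\<in>W. \<rho> (x \<otimes> b) w \<in> W}"
    proof (rule sna_generated)
      have "(0 :: 'n sna) \<otimes> b = 0" using tensor_scaleC_left[of 0 0 b] by simp
      then show "csubspace {x. \<forall>w\<in>W. \<rho> (x \<otimes> b) w \<in> W}"
        unfolding complex_vector.subspace_def
        by (auto simp: tensor_add_left tensor_scaleC_left rho_add_left rho_scaleC_left
            rho_zero_left W_closed)
    qed (use D t in \<open>auto simp: T_def\<close>)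
    then show ?case by simp
  next
    case (add x y)
    then show ?case by (simp add: rho_add_left W_closed)
  qed
  then have "W = {0} \<or> W = UNIV" using irreducible W unfolding irreducible_module_def by blast
  then show ?thesis using assms(4,5) by auto
qed

text \<open>The vectors killed by a power of a product of operators \<open>T r b\<close> form a submodule, because
  the brackets of such a product with the fields commute with it.\<close>

lemma locally_nilpotent:
  assumes "mon m w = 0" "w \<noteq> 0"
  shows "\<exists>k. (mon m ^^ k) v = 0"
proof -
  let ?Z = "mon m"
  note Z_lin = funpow_linear[of ?Z, OF mon_add mon_scaleC]
  have Z0: "(?Z ^^ k) 0 = 0" for k by (induction k) (simp_all add: mon_zero)
  have "v \<in> {v. \<exists>k. (?Z ^^ k) v = 0}"
  proof (rule submodule_trivial)
    show "csubspace {v. \<exists>k. (?Z ^^ k) v = 0}"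
      unfolding complex_vector.subspace_def mem_Collect_eq
    proof (intro conjI allI ballI impI; clarify?)
      fix x y k l assume "(?Z ^^ k) x = 0" "(?Z ^^ l) y = 0"
      then have "(?Z ^^ max k l) x = 0" "(?Z ^^ max k l) y = 0"
        using funpow_zero_mono[of ?Z, OF mon_zero] by (meson max.cobounded1 max.cobounded2)+
      then show "\<exists>k. (?Z ^^ k) (x + y) = 0" by (metis Z_lin(1) add_0)
    qed (use Z0 Z_lin(2) in \<open>auto simp: Z0 Z_lin(2) intro: exI[of _ 0]\<close>)
  next
    fix u c v and s :: "int ^ 'n"
    assume u: "cpair u s = 0" and "v \<in> {v. \<exists>k. (?Z ^^ k) v = 0}"
    then obtain k where k: "(?Z ^^ k) v = 0" by blast
    define U where "U v = (\<Sum>a\<in>#m. cpair u (fst a) *\<^sub>C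
      mon (add_mset (fst a + s, snd a * c) (m - {#a#})) v)" for v
    let ?D = "\<rho> (sna_D u s \<otimes> c)"
    have D0: "?D 0 = 0" using rho_scaleC_right[of _ 0 0] by simp
    have DZ: "?D (?Z v) = ?Z (?D v) + U v" for v
      unfolding U_def by (rule D_mon[OF u])
    have U0: "U 0 = 0" using DZ[of 0] by (simp add: mon_zero D0)
    have "?Z (U v) = U (?Z v)" for v
      unfolding U_def mon_sum_mset mon_scaleC mon_commute[of m] ..
    then have ZU: "(?Z ^^ k) (U v) = U ((?Z ^^ k) v)" for k v by (induction k) simp_all
    have "(?Z ^^ Suc k) (?D v) = 0"
      using k
    proof (induction k arbitrary: v)
      case 0
      then show ?case by (simp add: D0 mon_zero)
    next
      case (Suc k)
      have "(?Z ^^ k) (?Z v) = 0" using Suc.prems by (simp add: funpow_swap1)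
      then have "0 = (?Z ^^ Suc k) (?D (?Z v))" using Suc.IH by simp
      also have "\<dots> = (?Z ^^ Suc k) (?Z (?D v))"
        by (simp only: DZ Z_lin(1) ZU Suc.prems U0 add_0_right)
      finally show ?case by (simp add: funpow_swap1)
    qed
    then show "?D v \<in> {v. \<exists>k. (?Z ^^ k) v = 0}" by blast
  next
    fix r c v assume "v \<in> {v. \<exists>k. (?Z ^^ k) v = 0}"
    then obtain k where k: "(?Z ^^ k) v = 0" by blast
    have "?Z (T r c v) = T r c (?Z v)" for v
      using mon_commute[of m "{#(r, c)#}"] by simp
    then have "(?Z ^^ k) (T r c v) = T r c ((?Z ^^ k) v)" by (induction k) simp_all
    then show "T r c v \<in> {v. \<exists>k. (?Z ^^ k) v = 0}" using k by (auto simp: T_zero)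
  next
    show "w \<in> {v. \<exists>k. (?Z ^^ k) v = 0}" using assms(1) by (auto intro!: exI[of _ 1])
  qed (fact assms(2))
  then show ?thesis by simp
qed

text \<open>The exponents of the two factors add up to \<open>0\<close>, so their product preserves weights.\<close>

lemma pair_weight_space:
  assumes "v \<in> weight_space \<rho> cartan \<mu>"
  shows "mon {#(r, b), (- r, c)#} v \<in> weight_space \<rho> cartan \<mu>"
proof -
  let ?Z = "mon {#(r, b), (- r, c)#}"
  have "\<forall>v. \<rho> h (?Z v) = ?Z (\<rho> h v)" if "h \<in> cartan" for h
    using that unfolding cartan_def
  proof (induction rule: complex_vector.span_induct)
    case base
    show ?case
      unfolding complex_vector.subspace_def
      by (auto simp: rho_zero_left T_zero T_add T_scaleC rho_add_left rho_scaleC_left)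
  next
    case (step h)
    then obtain i where h: "h = sna_D (axis i 1) 0 \<otimes> 1" by (auto simp: sna_d_eq)
    have "cpair (axis i 1) (0 :: int ^ 'n) = 0" by (simp add: cpair_axis)
    then show ?case
      by (simp add: h D_T T_add T_diff T_scaleC cpair_minus_right)
  qed
  then show ?thesis
    using assms unfolding weight_space_def by (simp del: mon_add_mset add: mon_scaleC)
qed

text \<open>A property closed under sums holds everywhere as soon as it holds for weight vectors.\<close>

lemma weight_induct:
  assumes "\<And>\<mu> v. \<mu> \<in> dual_space cartan \<Longrightarrow> v \<in> weight_space \<rho> cartan \<mu> \<Longrightarrow> P v"
    and "P 0" "\<And>v w. P v \<Longrightarrow> P w \<Longrightarrow> P (v + w)"
  shows "P v"
proof -
  obtain w where w: "\<forall>\<mu>\<in>dual_space cartan. w \<mu> \<in> weight_space \<rho> cartan \<mu>"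
    "\<forall>\<mu>. \<mu> \<notin> dual_space cartan \<longrightarrow> w \<mu> = 0" "v = (\<Sum>\<mu> | w \<mu> \<noteq> 0. w \<mu>)"
    using bounded unfolding uniformly_bounded_weight_module_def weight_module_def by metis
  have "P (w \<mu>)" for \<mu> using w assms(1,2) by metis
  then have "P (sum w A)" for A
    by (induction A rule: infinite_finite_induct) (simp_all add: assms(2,3))
  then show ?thesis using w(3) by simp
qed

lemma dimension_bound:
  obtains M where "\<And>\<mu>. \<mu> \<in> dual_space cartan \<Longrightarrow>
    \<exists>S. finite S \<and> card S \<le> M \<and> cspan S = weight_space \<rho> cartan \<mu>"
  using bounded unfolding uniformly_bounded_weight_module_def by metis

lemma pair_nilpotent:
  assumes "mon {#(r, b), (- r, c)#} w = 0" "w \<noteq> 0"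
  shows "\<exists>M. vanishes (replicate_mset M (r, b) + replicate_mset M (- r, c))"
proof -
  let ?Z = "mon {#(r, b), (- r, c)#}"
  obtain M where M: "\<And>\<mu>. \<mu> \<in> dual_space cartan \<Longrightarrow>
      \<exists>S. finite S \<and> card S \<le> M \<and> cspan S = weight_space \<rho> cartan \<mu>"
    using dimension_bound by blast
  have Z: "(?Z ^^ M) v = 0" for v
  proof (induction v rule: weight_induct)
    case (1 \<mu> v)
    obtain S where S: "finite S" "card S \<le> M" "cspan S = weight_space \<rho> cartan \<mu>"
      using M[OF 1(1)] by blast
    obtain k where k: "(?Z ^^ k) v = 0" using locally_nilpotent[OF assms] by blast
    have "(?Z ^^ i) v \<in> cspan S" for i
      unfolding S(3) by (induction i) (simp_all del: mon_add_mset add: 1 pair_weight_space)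
    then show ?case
      using nilpotent_bound[of ?Z S M v k, OF mon_add mon_scaleC S(1,2) _ k] by blast
  next
    case 2
    show ?case by (rule funpow_zero_mono[of _ 0]) (simp_all add: T_zero)
  next
    case (3 v w)
    then show ?case by (simp only: funpow_linear(1)[of ?Z, OF mon_add mon_scaleC] add_0)
  qed
  have "repeat_mset M {#(r, b), (- r, c)#} = replicate_mset M (r, b) + replicate_mset M (- r, c)"
    by (rule multiset_eqI) simp
  then show ?thesis using Z by (metis mon_repeat vanishes_def)
qed

text \<open>The derivatives of \<open>T r b\<close> include \<open>T e\<^sub>i b\<close>, and those of \<open>T (-r) 1\<close> include it as
  well, so that both factors can be traded for powers of \<open>T e\<^sub>i b\<close>.\<close>

lemma axis_power_vanishes:
  assumes "i \<noteq> j" and van: "vanishes (replicate_mset M (axis i 1 + axis j 1, b)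
      + replicate_mset M (- (axis i 1 + axis j 1), 1))"
  shows "\<exists>K. vanishes (replicate_mset K (axis i 1, b))"
proof -
  let ?r = "axis i 1 + axis j 1 :: int ^ 'n" and ?p = "(axis i 1, b) :: (int ^ 'n) \<times> 'b"
  have rep: "repeat_mset k (replicate_mset l a) = replicate_mset (k * l) a"
    "replicate_mset k a + replicate_mset l a = replicate_mset (k + l) a"
    for k l and a :: "(int ^ 'n) \<times> 'b"
    by (auto intro!: multiset_eqI)
  have "vanishes (replicate_mset (2 * M) ?p + repeat_mset (Suc M) (replicate_mset M (- ?r, 1)))"
    by (rule vanishes_all_derivatives[OF van]) (use linked_sum_axis(1)[OF assms(1)] in \<open>auto split: if_splits\<close>)
  then have "vanishes (replicate_mset (Suc M * M) (- ?r, 1) + replicate_mset (2 * M) ?p)"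
    by (simp only: rep add.commute)
  then have "vanishes (replicate_mset (2 * (Suc M * M)) ?p +
      repeat_mset (Suc (Suc M * M)) (replicate_mset (2 * M) ?p))"
    by (rule vanishes_all_derivatives) (use linked_sum_axis(2)[OF assms(1)] in \<open>auto split: if_splits\<close>)
  then show ?thesis unfolding rep by blast
qed

lemma submultiset_of_size:
  assumes "n \<le> size m"
  shows "\<exists>m'. m' \<subseteq># m \<and> size m' = n"
proof -
  obtain xs where "mset xs = m" using ex_mset by blast
  then have "mset (take n xs) \<subseteq># m"
    by (metis append_take_drop_id mset_append mset_subset_eq_add_left)
  then show ?thesis
    using assms \<open>mset xs = m\<close> by (intro exI[of _ "mset (take n xs)"]) auto
qed

text \<open>Every nonzero exponent is linked to \<open>e\<^sub>i\<close> or to \<open>e\<^sub>j\<close>, so at least half of the factors are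
  derivatives of one of the two nilpotent operators.\<close>

lemma long_products_vanish:
  assumes "i \<noteq> j" and i: "vanishes (replicate_mset K (axis i 1, b))"
    and j: "vanishes (replicate_mset K (axis j 1, b))"
    and m: "size m = 4 * K" "\<And>a. a \<in># m \<Longrightarrow> fst a \<noteq> 0 \<and> b dvd snd a"
  shows "vanishes m"
proof -
  have *: "vanishes m" if van: "vanishes (replicate_mset K (p, b))"
    and size: "2 * K \<le> size (filter_mset P m)"
    and linked: "\<And>a. a \<in># m \<Longrightarrow> P a \<Longrightarrow> linked p (fst a)" for p P
  proof -
    obtain m' where m': "m' \<subseteq># filter_mset P m" "size m' = 2 * K"
      using submultiset_of_size[OF size] by blast
    have "a \<in># m \<and> P a" if "a \<in># m'" for a
      using mset_subset_eqD[OF m'(1) that] by simp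
    then have "vanishes (m' + repeat_mset (Suc K) {#})"
      using van m'(2) linked m(2) by (intro vanishes_all_derivatives[where b = b and r = p]) auto
    then have "vanishes m'" by simp
    then show ?thesis
      using m'(1) by (meson multiset_filter_subset subset_mset.order_trans vanishes_mono)
  qed
  let ?P = "\<lambda>a. linked (axis i 1) (fst a)"
  have "size (filter_mset ?P m) + size (filter_mset (\<lambda>a. \<not> ?P a) m) = 4 * K"
    using m(1) by (metis multiset_partition size_union)
  then consider "2 * K \<le> size (filter_mset ?P m)" | "2 * K \<le> size (filter_mset (\<lambda>a. \<not> ?P a) m)"
    by linarith
  then show ?thesis
  proof cases
    case 1
    then show ?thesis using *[OF i, of ?P] by blast
  next
    case 2
    have "linked (axis j 1) (fst a)" if a: "a \<in># m" "\<not> ?P a" for a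
    proof -
      obtain k where k: "fst a $ k \<noteq> 0" using m(2)[OF a(1)] by (auto simp: vec_eq_iff)
      then have "k = i" using linked_axis a(2) by blast
      then show ?thesis using linked_axis k \<open>i \<noteq> j\<close> by blast
    qed
    then show ?thesis using *[OF j 2] by blast
  qed
qed

lemma two_directions:
  obtains i j :: 'n where "i \<noteq> j"
  using rank card_le_Suc0_iff_eq[of "UNIV :: 'n set"] by force

text \<open>When products of length \<open>n\<close> vanish but shorter ones do not, a nonzero product of length \<open>n - 1\<close>
  yields a nonzero vector killed by all \<open>T q (b c)\<close>, and the vectors with this property form a
  submodule.\<close>

lemma products_vanish_imp_zero:
  assumes van: "\<And>m. size m = n \<Longrightarrow> (\<And>a. a \<in># m \<Longrightarrow> fst a \<noteq> 0 \<and> b dvd snd a) \<Longrightarrow> vanishes m"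
    and "q \<noteq> 0"
  shows "T q (b * c) v = 0"
  using van
proof (induction n)
  case 0
  have "vanishes {#}" by (rule 0) simp_all
  then have "x = 0" for x :: 'v by (simp add: vanishes_def)
  then show ?case by blast
next
  case (Suc n)
  define W where "W = {v. \<forall>q c. q \<noteq> 0 \<longrightarrow> T q (b * c) v = 0}"
  show ?case
  proof (cases "\<exists>w\<in>W. w \<noteq> 0")
    case True
    then obtain w0 where w0: "w0 \<in> W" "w0 \<noteq> 0" by blast
    have "v \<in> W"
    proof (rule submodule_trivial)
      show "csubspace W"
        by (auto simp: complex_vector.subspace_def W_def T_zero T_add T_scaleC)
      show "T r c w \<in> W" if "w \<in> W" for r c w
        using that by (simp add: W_def T_commute[of _ _ r c] T_zero)
      show "\<rho> (sna_D u s \<otimes> c) w \<in> W" if u: "cpair u s = 0" and w: "w \<in> W" for u s c w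
        unfolding W_def mem_Collect_eq
      proof (intro allI impI)
        fix q d assume "(q :: int ^ 'n) \<noteq> 0"
        have D0: "\<rho> x 0 = 0" for x using rho_scaleC_right[of x 0 0] by simp
        \<comment> \<open>The field \<open>D(u, - q)\<close>, which would lead to exponent \<open>0\<close>, annihilates \<open>t\<^sup>q\<close>.\<close>
        have "cpair u q *\<^sub>C T (q + s) (b * d * c) w = 0"
        proof (cases "q + s = 0")
          case True
          then have "q = - s" by (simp add: eq_neg_iff_add_eq_0)
          then show ?thesis using u by (simp add: cpair_minus_right)
        next
          case False
          then show ?thesis using w by (simp add: W_def mult.assoc)
        qed
        moreover have "T q (b * d) w = 0" using w \<open>q \<noteq> 0\<close> by (simp add: W_def)
        ultimately show "T q (b * d) (\<rho> (sna_D u s \<otimes> c) w) = 0"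
          using D_T[OF u, of c q "b * d" w] by (auto simp: D0)
      qed
    qed (fact w0)+
    then show ?thesis using \<open>q \<noteq> 0\<close> by (simp add: W_def)
  next
    case False
    show ?thesis
    proof (rule Suc.IH)
      fix m :: "((int ^ 'n) \<times> 'b) multiset"
      assume m: "size m = n" "\<And>a. a \<in># m \<Longrightarrow> fst a \<noteq> 0 \<and> b dvd snd a"
      have "mon m x \<in> W" for x
        unfolding W_def mem_Collect_eq
      proof (intro allI impI)
        fix q c assume "(q :: int ^ 'n) \<noteq> 0"
        then have "vanishes (add_mset (q, b * c) m)" using m by (intro Suc.prems) auto
        then show "T q (b * c) (mon m x) = 0" by (simp add: vanishes_def)
      qed
      then show "vanishes m" using False by (auto simp: vanishes_def)
    qed
  qed
qed

lemma pair_kills_imp_zero: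
  assumes "i \<noteq> j" and r: "r = axis i 1 + axis j 1"
    and w: "T r b (T (- r) 1 w) = 0" "w \<noteq> 0" and "q \<noteq> 0"
  shows "T q (b * c) v = 0"
proof -
  obtain M where M: "vanishes (replicate_mset M (r, b) + replicate_mset M (- r, 1))"
    using pair_nilpotent[of r b 1 w] w by auto
  obtain K where K: "vanishes (replicate_mset K (axis i 1, b))"
    using axis_power_vanishes[OF \<open>i \<noteq> j\<close>] M r by blast
  obtain L where L: "vanishes (replicate_mset L (axis j 1, b))"
    using axis_power_vanishes[of j i] \<open>i \<noteq> j\<close> M r by (metis add.commute)
  have mono: "replicate_mset k a \<subseteq># replicate_mset l a" if "k \<le> l"
    for k l and a :: "(int ^ 'n) \<times> 'b"
    using that by (auto simp: subseteq_mset_def)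
  have "vanishes (replicate_mset (max K L) (axis i 1, b))"
    "vanishes (replicate_mset (max K L) (axis j 1, b))"
    using vanishes_mono[OF K mono] vanishes_mono[OF L mono] by simp_all
  note long_products_vanish[OF \<open>i \<noteq> j\<close> this]
  then show ?thesis using \<open>q \<noteq> 0\<close> by (rule products_vanish_imp_zero)
qed

text \<open>The hypothesis excludes \<open>b = 1\<close> in \<open>pair_kills_imp_zero\<close>, so that the operator \<open>X\<close> of the
  proof is injective.\<close>

lemma scalar_exists:
  assumes s: "s \<noteq> 0" "T s 1 v0 \<noteq> 0"
  shows "\<exists>a. \<forall>q c v. q \<noteq> 0 \<longrightarrow> T q (b * c) v = a *\<^sub>C T q c v"
proof -
  obtain i j :: 'n where ij: "i \<noteq> j" by (rule two_directions)
  define r :: "int ^ 'n" where "r = axis i 1 + axis j 1"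
  let ?X = "mon {#(r, 1), (- r, 1)#}" and ?Y = "mon {#(r, b), (- r, 1)#}"
  have inj: "v = 0" if "?X v = 0" for v
    using pair_kills_imp_zero[OF ij r_def, of 1 v s 1 v0] that s by auto
  obtain M where M: "\<And>\<mu>. \<mu> \<in> dual_space cartan \<Longrightarrow>
      \<exists>S. finite S \<and> card S \<le> M \<and> cspan S = weight_space \<rho> cartan \<mu>"
    using dimension_bound by blast
  have "\<exists>\<mu>\<in>dual_space cartan. \<exists>x\<in>weight_space \<rho> cartan \<mu>. x \<noteq> 0"
  proof (rule ccontr)
    assume no: "\<not> ?thesis"
    have "v0 = 0"
    proof (induction v0 rule: weight_induct)
      case (1 \<mu> v)
      then show ?case using no by blast
    qed simp_all
    then show False using s(2) T_zero by simp
  qed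
  then obtain \<mu> x where \<mu>: "\<mu> \<in> dual_space cartan" and x: "x \<in> weight_space \<rho> cartan \<mu>" "x \<noteq> 0"
    by blast
  obtain S where S: "finite S" "card S \<le> M" "cspan S = weight_space \<rho> cartan \<mu>"
    using M[OF \<mu>] by blast
  define f where "f i = (?X ^^ (M - i)) ((?Y ^^ i) x)" for i
  have Y_in: "(?Y ^^ i) x \<in> cspan S" for i
    unfolding S(3) by (induction i) (simp_all del: mon_add_mset add: x pair_weight_space)
  have "(?X ^^ k) ((?Y ^^ i) x) \<in> cspan S" for k i
    using Y_in[of i] unfolding S(3)
    by (induction k) (simp_all del: mon_add_mset add: pair_weight_space)
  then have "f i \<in> cspan S" for i unfolding f_def .
  then obtain c where c: "\<exists>i\<le>M. c i \<noteq> 0" "(\<Sum>i\<le>M. c i *\<^sub>C f i) = 0"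
    using linear_relation_of_bounded_dimension[OF S(1,2), of f] by auto
  define p where "p = (\<Sum>i\<le>M. monom (c i) i)"
  have p: "coeff p i = (if i \<le> M then c i else 0)" for i
    by (simp add: p_def coeff_sum)
  obtain i0 where "i0 \<le> M" "c i0 \<noteq> 0" using c(1) by blast
  then have "coeff p i0 \<noteq> 0" by (simp add: p)
  then have "p \<noteq> 0" by auto
  have "degree p \<le> M" by (rule degree_le) (simp add: p)
  have "(\<Sum>i\<le>M. coeff p i *\<^sub>C f i) = 0"
    using c(2) by (simp add: p)
  then have rel: "(\<Sum>i\<le>M. coeff p i *\<^sub>C (?X ^^ (M - i)) ((?Y ^^ i) x)) = 0"
    by (simp only: f_def)
  have "\<exists>a w. w \<noteq> 0 \<and> ?Y w = a *\<^sub>C ?X w"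
    by (rule pencil_kernel[of ?X ?Y p M x, OF mon_add mon_scaleC mon_add mon_scaleC mon_commute inj
        \<open>p \<noteq> 0\<close> \<open>degree p \<le> M\<close> x(2) rel])
  then obtain a w where w: "w \<noteq> 0" "?Y w = a *\<^sub>C ?X w" by blast
  have diff: "T q (b' - a *\<^sub>C c') v = T q b' v - a *\<^sub>C T q c' v" for q b' c' v
    using T_add_coeff[of q "b' - a *\<^sub>C c'" "a *\<^sub>C c'" v] by (simp add: T_scaleC_coeff)
  have "T r (b - a *\<^sub>C 1) (T (- r) 1 w) = 0"
    using w(2) by (simp add: diff)
  then have zero: "T q ((b - a *\<^sub>C 1) * c) v = 0" if "q \<noteq> 0" for q c v
    using pair_kills_imp_zero[OF ij r_def _ w(1) that] by blast
  have "(b - a *\<^sub>C 1) * c = b * c - a *\<^sub>C c" for c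
    by (simp add: left_diff_distrib scaleC_mult_left)
  then have "T q (b * c) v = a *\<^sub>C T q c v" if "q \<noteq> 0" for q c v
    using zero[OF that, of c v] by (simp add: diff)
  then show ?thesis by blast
qed

end

theorem proposition3p7:
  fixes \<rho> :: "('n::finite sna, 'b::complex_comm_algebra_1) tensor \<Rightarrow> 'v::complex_vector \<Rightarrow> 'v"
  assumes "CARD('n) \<ge> 2"
    and "finitely_generated_algebra TYPE('b)"
    and "irreducible_module \<rho>"
    and "uniformly_bounded_weight_module \<rho> cartan"
    and "\<exists>v. \<rho> (sna_t 0 \<otimes> 1) v \<noteq> 0"
    and "\<exists>s. s \<noteq> 0 \<and> (\<exists>v. \<rho> (sna_t s \<otimes> 1) v \<noteq> 0)"
  shows "\<exists>\<psi> :: 'b \<Rightarrow> complex. algebra_hom_to_complex \<psi> \<and>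
    (\<forall>r b v. r \<noteq> 0 \<longrightarrow> \<rho> (sna_t r \<otimes> b) v = \<psi> b *\<^sub>C \<rho> (sna_t r \<otimes> 1) v)"
proof -
  interpret bounded_irreducible_sna_module \<rho>
    using assms(1,3,4) by unfold_locales (simp_all add: irreducible_module_def)
  obtain s v0 where s: "s \<noteq> 0" "T s 1 v0 \<noteq> 0" using assms(6) by (auto simp: T_def)
  have "\<forall>b. \<exists>a. \<forall>q c v. q \<noteq> 0 \<longrightarrow> T q (b * c) v = a *\<^sub>C T q c v"
    using scalar_exists[OF s] by blast
  from choice[OF this]
  obtain \<psi> where \<psi>: "\<And>b q c v. q \<noteq> 0 \<Longrightarrow> T q (b * c) v = \<psi> b *\<^sub>C T q c v"
    by blast
  have \<psi>1: "T q b v = \<psi> b *\<^sub>C T q 1 v" if "q \<noteq> 0" for q b v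
    using \<psi>[OF that, of b 1 v] by simp
  have eqI: "x = y" if "x *\<^sub>C T s 1 v0 = y *\<^sub>C T s 1 v0" for x y
    using that s(2) by (simp add: complex_vector.scale_cancel_right)
  have "algebra_hom_to_complex \<psi>"
    unfolding algebra_hom_to_complex_def
  proof (intro conjI allI; rule eqI)
    fix x y :: 'b and a
    show "\<psi> (x + y) *\<^sub>C T s 1 v0 = (\<psi> x + \<psi> y) *\<^sub>C T s 1 v0"
      by (simp only: scaleC_add_left \<psi>1[OF s(1), symmetric] T_add_coeff)
    show "\<psi> (a *\<^sub>C x) *\<^sub>C T s 1 v0 = (a * \<psi> x) *\<^sub>C T s 1 v0"
      by (simp only: scaleC_scaleC[symmetric] \<psi>1[OF s(1), symmetric] T_scaleC_coeff)
    show "\<psi> (x * y) *\<^sub>C T s 1 v0 = (\<psi> x * \<psi> y) *\<^sub>C T s 1 v0"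
      by (simp only: scaleC_scaleC[symmetric] \<psi>1[OF s(1), symmetric] \<psi>[OF s(1), of x y, symmetric])
    show "\<psi> 1 *\<^sub>C T s 1 v0 = 1 *\<^sub>C T s 1 v0"
      by (simp only: \<psi>1[OF s(1), symmetric] scaleC_one)
  qed
  then show ?thesis using \<psi>1 unfolding T_def by blast
qed

end
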